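(* The discrete affine group $\mathrm{DA}(\mathbb{T})$, equipped with a word metric, admits a bi-Lipschitz embedding into $L_1$, and for all real $p\ge 1$ its $L_p$-compression exponent is $$\alpha_p^\ast\left(\mathrm{DA}(\mathbb{T})\right)=\max\left\{\frac1p,\frac12\right\}.$$
   Context: Tree and groups. Fix an integer $q\ge 2$, let $\mathcal{A}_q=\{0,\dots,q-1\}$, and let the symmetric group $\mathfrak{S}_q$ act on $\mathcal{A}_q$ on the right, $t\mapsto t.\sigma$. For $m\in\mathbb{Z}$ let $H_m$ be the set of sequences $(u_k)_{k\le m}$ indexed by integers $k\le m$, with values in $\mathcal{A}_q$, and equal to $0$ for all sufficiently negative $k$. The $(q+1)$-regular tree $\mathbb{T}$ has vertex set $\bigsqcup_{m\in\mathbb{Z}}H_m$, each vertex of $H_m$ being joined by an edge to its ancestor in $H_{m-1}$ obtained by deleting the last entry; for a vertex $v$ and $t\in\mathcal{A}_q$, $vt$ is the child of $v$ obtained by appending $t$. Let $\omega(n)\in H_{-n}$ be the zero sequence, $o=\omega(0)$, and $\omega$ the end of $\mathbb{T}$ represented by the ray $(\omega(n))_{n\ge0}$. $\mathrm{Aff}(\mathbb{T})$ is the group of graph automorphisms of $\mathbb{T}$ fixing $\omega$; it acts on the right ($v\mapsto v.g$; in $gh$, $g$ is applied first). Put $\beta(v)=m$ for $v\in H_m$ and let $\Phi:\mathrm{Aff}(\mathbb{T})\to\mathbb{Z}$ be the homomorphism $\Phi(g)=\beta(v.g)-\beta(v)$ (independent of $v$), with kernel $\mathrm{Hor}(\mathbb{T})$.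 Let $\alpha\in\mathrm{Aff}(\mathbb{T})$ be the shift $(u_k)_{k\le m}\mapsto(u_{k-1})_{k\le m+1}$, so $\Phi(\alpha)=1$. For $\gamma\in\mathrm{Hor}(\mathbb{T})$ the portrait of $\gamma$ is the function $v\mapsto\gamma[v]\in\mathfrak{S}_q$ determined by $(vt).\gamma=(v.\gamma)(t.\gamma[v])$ for all vertices $v$ and $t\in\mathcal{A}_q$. Every $g\in\mathrm{Aff}(\mathbb{T})$ is uniquely $g=\gamma\alpha^m$ with $\gamma\in\mathrm{Hor}(\mathbb{T})$, $m\in\mathbb{Z}$, and one sets $g[v]:=\gamma[v]$. The discrete affine group is $\mathrm{DA}(\mathbb{T})=\{g\in\mathrm{Aff}(\mathbb{T}): g[v]=e \text{ for all but finitely many } v\}$; it is finitely generated. Compression exponent. For a finitely generated group $\Gamma$ with word metric $d_\Gamma$ and $1\le p<\infty$, $\alpha_p^\ast(\Gamma)$ is the supremum of all $\alpha\ge0$ for which there exist a Lipschitz map $f:\Gamma\to L_p$ and a constant $c>0$ such that $\|f(x)-f(y)\|_p\ge c\,d_\Gamma(x,y)^\alpha$ for all $x,y\in\Gamma$. It does not depend on the choice of finite generating set. *)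

theory Defs
  imports "HOL-Analysis.Analysis" "HOL-Algebra.Algebra" "HOL-Combinatorics.Permutations"
begin

section \<open>The tree\<close>

text \<open>A vertex of level \<open>m\<close> is a pair \<open>(m, u)\<close>. The sequence \<open>(u\<^sub>k)\<close>, \<open>k \<le> m\<close>, is an extensional
  function on \<open>{..m}\<close>, so that distinct functions in \<open>H q m\<close> are distinct sequences.\<close>

type_synonym vertex = "int \<times> (int \<Rightarrow> nat)"

definition H :: "nat \<Rightarrow> int \<Rightarrow> (int \<Rightarrow> nat) set" where
  "H q m = {u \<in> {..m} \<rightarrow>\<^sub>E {..<q}. \<forall>\<^sub>F k in at_bot. u k = 0}"

definition vertices :: "nat \<Rightarrow> vertex set" where
  "vertices q = (SIGMA m:UNIV. H q m)"

definition ancestor :: "vertex \<Rightarrow> vertex" where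
  "ancestor v = (fst v - 1, restrict (snd v) {..fst v - 1})"

definition child :: "vertex \<Rightarrow> nat \<Rightarrow> vertex" where
  "child v t = (fst v + 1, (snd v)(fst v + 1 := t))"

definition adjacent :: "nat \<Rightarrow> vertex \<Rightarrow> vertex \<Rightarrow> bool" where
  "adjacent q v w \<longleftrightarrow>
     v \<in> vertices q \<and> w \<in> vertices q \<and> (w = ancestor v \<or> v = ancestor w)"

definition level :: "vertex \<Rightarrow> int" where
  "level v = fst v"

definition omega_ray :: "nat \<Rightarrow> vertex" where
  "omega_ray n = (- int n, restrict (\<lambda>_. 0) {..- int n})"

text \<open>Two rays of a tree represent the same end iff they have a common tail.\<close>

definition same_end :: "(nat \<Rightarrow> vertex) \<Rightarrow> (nat \<Rightarrow> vertex) \<Rightarrow> bool" where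
  "same_end r s \<longleftrightarrow> (\<exists>i j. \<forall>n. r (i + n) = s (j + n))"


section \<open>The affine group of the tree and the discrete affine group\<close>

text \<open>Automorphisms are permutations of the vertex set, extended by the identity to the rest of
  the type. They act on the right: \<open>g v\<close> stands for $v.g$, and in \<open>g \<otimes> h\<close> the factor \<open>g\<close> is
  applied first.\<close>

definition Aff :: "nat \<Rightarrow> (vertex \<Rightarrow> vertex) monoid" where
  "Aff q =
    \<lparr>carrier = {g. g permutes vertices q \<and>
        (\<forall>v\<in>vertices q. \<forall>w\<in>vertices q. adjacent q (g v) (g w) \<longleftrightarrow> adjacent q v w) \<and>
        same_end (g \<circ> omega_ray) omega_ray},
     mult = (\<lambda>g h. h \<circ> g),
     one = id\<rparr>"

text \<open>The difference \<open>level (g v) - level v\<close> does not depend on the vertex \<open>v\<close>; it is taken at the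
  root \<open>omega_ray 0\<close>.\<close>

definition Phi :: "(vertex \<Rightarrow> vertex) \<Rightarrow> int" where
  "Phi g = level (g (omega_ray 0)) - level (omega_ray 0)"

definition Hor :: "nat \<Rightarrow> (vertex \<Rightarrow> vertex) set" where
  "Hor q = {g \<in> carrier (Aff q). Phi g = 0}"

definition shift :: "nat \<Rightarrow> vertex \<Rightarrow> vertex" where
  "shift q v = (if v \<in> vertices q then (fst v + 1, \<lambda>k. snd v (k - 1)) else v)"

definition hor_portrait :: "nat \<Rightarrow> (vertex \<Rightarrow> vertex) \<Rightarrow> vertex \<Rightarrow> nat \<Rightarrow> nat" where
  "hor_portrait q \<gamma> v =
    (THE \<sigma>. \<sigma> permutes {..<q} \<and> (\<forall>t<q. \<gamma> (child v t) = child (\<gamma> v) (\<sigma> t)))"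

definition hor_part :: "nat \<Rightarrow> (vertex \<Rightarrow> vertex) \<Rightarrow> vertex \<Rightarrow> vertex" where
  "hor_part q g =
    (THE \<gamma>. \<gamma> \<in> Hor q \<and> (\<exists>m::int. g = \<gamma> \<otimes>\<^bsub>Aff q\<^esub> (shift q [^]\<^bsub>Aff q\<^esub> m)))"

definition portrait :: "nat \<Rightarrow> (vertex \<Rightarrow> vertex) \<Rightarrow> vertex \<Rightarrow> nat \<Rightarrow> nat" where
  "portrait q g = hor_portrait q (hor_part q g)"

definition DA :: "nat \<Rightarrow> (vertex \<Rightarrow> vertex) monoid" where
  "DA q = (Aff q)\<lparr>carrier :=
     {g \<in> carrier (Aff q). finite {v \<in> vertices q. portrait q g v \<noteq> id}}\<rparr>"


section \<open>Word metrics\<close>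

definition finite_generating_set :: "('a, 'b) monoid_scheme \<Rightarrow> 'a set \<Rightarrow> bool" where
  "finite_generating_set G S \<longleftrightarrow>
     finite S \<and> S \<subseteq> carrier G \<and> generate G S = carrier G"

definition word_length :: "('a, 'b) monoid_scheme \<Rightarrow> 'a set \<Rightarrow> 'a \<Rightarrow> nat" where
  "word_length G S x =
    (LEAST n. \<exists>w. length w = n \<and> set w \<subseteq> S \<union> m_inv G ` S \<and> foldr (mult G) w \<one>\<^bsub>G\<^esub> = x)"

definition word_dist :: "('a, 'b) monoid_scheme \<Rightarrow> 'a set \<Rightarrow> 'a \<Rightarrow> 'a \<Rightarrow> real" where
  "word_dist G S x y = real (word_length G S (inv\<^bsub>G\<^esub> x \<otimes>\<^bsub>G\<^esub> y))"


section \<open>Embeddings into Lebesgue spaces\<close>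

text \<open>\<open>L\<^sub>p\<close> is $L_p([0,1])$. Its elements are given by representatives, not by classes of functions
  that agree almost everywhere; all notions below depend only on the classes.\<close>

definition Lp_space :: "real \<Rightarrow> (real \<Rightarrow> real) set" where
  "Lp_space p = {f \<in> borel_measurable (lebesgue_on {0..1}).
      integrable (lebesgue_on {0..1}) (\<lambda>x. \<bar>f x\<bar> powr p)}"

definition Lp_norm :: "real \<Rightarrow> (real \<Rightarrow> real) \<Rightarrow> real" where
  "Lp_norm p f = (LINT x|lebesgue_on {0..1}. \<bar>f x\<bar> powr p) powr (1 / p)"

definition Lp_dist :: "real \<Rightarrow> (real \<Rightarrow> real) \<Rightarrow> (real \<Rightarrow> real) \<Rightarrow> real" where
  "Lp_dist p f g = Lp_norm p (\<lambda>x. f x - g x)"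

definition lipschitz_into_Lp ::
    "real \<Rightarrow> ('a, 'b) monoid_scheme \<Rightarrow> 'a set \<Rightarrow> ('a \<Rightarrow> real \<Rightarrow> real) \<Rightarrow> bool" where
  "lipschitz_into_Lp p G S f \<longleftrightarrow>
     f \<in> carrier G \<rightarrow> Lp_space p \<and>
     (\<exists>C. \<forall>x\<in>carrier G. \<forall>y\<in>carrier G. Lp_dist p (f x) (f y) \<le> C * word_dist G S x y)"

definition bilipschitz_into_Lp ::
    "real \<Rightarrow> ('a, 'b) monoid_scheme \<Rightarrow> 'a set \<Rightarrow> ('a \<Rightarrow> real \<Rightarrow> real) \<Rightarrow> bool" where
  "bilipschitz_into_Lp p G S f \<longleftrightarrow>
     lipschitz_into_Lp p G S f \<and>
     (\<exists>c>0. \<forall>x\<in>carrier G. \<forall>y\<in>carrier G. c * word_dist G S x y \<le> Lp_dist p (f x) (f y))"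

text \<open>The supremum is taken in \<open>ereal\<close>, where it exists without a boundedness condition (it is
  \<open>\<infinity>\<close> for finite groups).\<close>

definition compression_exponent ::
    "real \<Rightarrow> ('a, 'b) monoid_scheme \<Rightarrow> 'a set \<Rightarrow> ereal" where
  "compression_exponent p G S = Sup {ereal a | a. 0 \<le> a \<and>
     (\<exists>f c. lipschitz_into_Lp p G S f \<and> c > 0 \<and>
        (\<forall>x\<in>carrier G. \<forall>y\<in>carrier G.
           Lp_dist p (f x) (f y) \<ge> c * word_dist G S x y powr a))}"

end

theory Submission
  imports Defs
begin

text \<open>An element \<open>x\<close> is determined by its position \<open>pos x\<close>, the vertex that \<open>x\<close> sends to the root, and its
  portrait. As in a lamplighter group, right multiplication by a generator moves the position to a
  neighbour or changes the portrait at the position. Hence the word distance of \<open>x\<close> and \<open>y\<close> is, up to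
  constants, the number of edges of the subtree spanned by \<open>pos x\<close>, \<open>pos y\<close> and the vertices at which the
  portraits differ. These are the edges \<open>w\<close> such that \<open>pos x\<close> and \<open>pos y\<close> are on different sides of \<open>w\<close> or
  the portraits differ on the side of \<open>w\<close> that contains neither. So the distance is comparable with the
  cardinality of a symmetric difference of sets attached to \<open>x\<close> and \<open>y\<close>. Sending the elements of
  these sets to disjointly supported functions (\<open>p \<le> 2\<close>) or to orthonormal cosines (\<open>p \<ge> 2\<close>) gives the
  lower bound, and the bi-Lipschitz embedding for \<open>p = 1\<close>.

  Conversely, let \<open>A\<close> range over the subsets of a set of $N = 2^n$ vertices of level 0 below \<open>omega_ray n\<close>.
  The elements that exchange two children of each vertex in \<open>A\<close> form a cube of dimension $N$
  with edges of length $O(n)$ and diagonals of length at least $c N$. An Enflo-type inequality,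
  in which the sum of the $p$-th powers of the diagonals is at most a constant times $N^{\max(p/2-1,0)}$
  times the sum of those of the edges, then forces $a p \le \max(p/2, 1)$ for an exponent $a$.\<close>

section \<open>The tree\<close>

text \<open>An edge stores the portrait on the side away from the position. A rotation changes the
  portrait at the position only, which lies on the near side of every edge, so no edge notices it; a
  shift moves the position across one edge, and only the data of this edge change. The price is that
  the local permutation at the position is invisible to all edges, whence the additive 1 that
  accompanies the count of edges. Walking from \<open>x\<close> to \<open>y\<close> meets one
  obstacle: a shift descends only to the child to which the local permutation assigns 0, so a
  descent may require a rotation that could spoil a finished local permutation. It never does,
  because the local permutation of \<open>y\<close> at a vertex assigns 0 to the child that leads to
  \<open>pos y\<close>. The upper bound rests on exponential growth: the leaves that index the
  coordinates of the cube are at distance logarithmic in their number. Logarithms do not influence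
  exponents, so the cube is as good as one with edges of bounded length.\<close>

locale regular_tree =
  fixes q :: nat
  assumes q2: "2 \<le> q"
begin

abbreviation V :: "vertex set" where "V \<equiv> vertices q"
abbreviation pinv :: "('a \<Rightarrow> 'b) \<Rightarrow> 'b \<Rightarrow> 'a" where "pinv \<equiv> inv_into UNIV"
abbreviation orig :: vertex where "orig \<equiv> omega_ray 0"

lemma in_V_iff: "(m, u) \<in> V \<longleftrightarrow>
    (\<forall>k\<le>m. u k < q) \<and> (\<forall>k>m. u k = undefined) \<and> (\<exists>N. \<forall>k\<le>N. u k = 0)"
  by (auto simp: vertices_def H_def PiE_def Pi_def extensional_def eventually_at_bot_linorder not_le)

lemma ancestor_in_V [simp]: "v \<in> V \<Longrightarrow> ancestor v \<in> V"
proof (cases v)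
  case (Pair m u)
  assume "v \<in> V"
  then obtain N where N: "\<forall>k\<le>N. u k = 0" and u: "\<forall>k\<le>m. u k < q" "\<forall>k>m. u k = undefined"
    using Pair in_V_iff by auto
  have "\<forall>k\<le>min N (m - 1). restrict u {..m - 1} k = 0" using N by auto
  then have "\<exists>N. \<forall>k\<le>N. restrict u {..m - 1} k = 0" by blast
  then show ?thesis using u Pair by (simp add: ancestor_def in_V_iff)
qed

lemma child_in_V [simp]: "v \<in> V \<Longrightarrow> t < q \<Longrightarrow> child v t \<in> V"
proof (cases v)
  case (Pair m u)
  assume "v \<in> V" and t: "t < q"
  then obtain N where N: "\<forall>k\<le>N. u k = 0" and u: "\<forall>k\<le>m. u k < q" "\<forall>k>m. u k = undefined"
    using Pair in_V_iff by auto
  have "\<forall>k\<le>min N m. (u(m + 1 := t)) k = 0" using N by auto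
  then have "\<exists>N. \<forall>k\<le>N. (u(m + 1 := t)) k = 0" by blast
  then show ?thesis using u t Pair by (simp add: child_def in_V_iff)
qed

lemma ancestor_child [simp]: "v \<in> V \<Longrightarrow> ancestor (child v t) = v"
  by (cases v) (auto simp: in_V_iff child_def ancestor_def restrict_def fun_eq_iff)

lemma fst_ancestor [simp]: "fst (ancestor v) = fst v - 1"
  by (simp add: ancestor_def)

lemma fst_child [simp]: "fst (child v t) = fst v + 1"
  by (simp add: child_def)

lemma snd_child_last [simp]: "snd (child v t) (fst v + 1) = t"
  by (simp add: child_def)

lemma child_ancestor: "v \<in> V \<Longrightarrow> child (ancestor v) (snd v (fst v)) = v"
  by (cases v) (auto simp: in_V_iff child_def ancestor_def restrict_def fun_eq_iff)

lemma last_digit_less: "v \<in> V \<Longrightarrow> snd v (fst v) < q"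
  by (cases v) (auto simp: in_V_iff)

lemma child_eq_iff [simp]:
  assumes "v \<in> V" "w \<in> V" shows "child v s = child w t \<longleftrightarrow> v = w \<and> s = t"
  using assms ancestor_child snd_child_last by metis

lemma ancestor_pow_in_V [simp]: "v \<in> V \<Longrightarrow> (ancestor ^^ n) v \<in> V"
  by (induction n) auto

lemma fst_ancestor_pow [simp]: "fst ((ancestor ^^ n) v) = fst v - int n"
  by (induction n) auto

lemma ancestor_pow:
  assumes "v \<in> V"
  shows "(ancestor ^^ n) v = (fst v - int n, restrict (snd v) {..fst v - int n})"
proof (induction n)
  case 0
  then show ?case using assms by (cases v) (auto simp: in_V_iff restrict_def fun_eq_iff)
next
  case (Suc n)
  then show ?case
    by (auto simp: ancestor_def restrict_def fun_eq_iff algebra_simps)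
qed

lemma omega_ray_in_V [simp]: "omega_ray n \<in> V"
  using q2 by (auto simp: omega_ray_def in_V_iff intro!: exI[of _ "- int n"])

lemma omega_ray_eq: "omega_ray n = (ancestor ^^ n) orig"
  using ancestor_pow[OF omega_ray_in_V, of n 0] by (auto simp: omega_ray_def restrict_def fun_eq_iff)

lemma fst_omega_ray [simp]: "fst (omega_ray n) = - int n"
  by (simp add: omega_ray_def)

text \<open>Far enough to the left all digits vanish, so sufficiently short truncations are zero
  sequences. The two offsets have the shape that \<open>same_end\<close> asks for.\<close>

lemma ancestor_pow_eq_omega_ray:
  assumes "v \<in> V"
  obtains i j where "\<And>n. (ancestor ^^ (i + n)) v = omega_ray (j + n)"
proof -
  obtain m u where v: "v = (m, u)" by (cases v)
  obtain N where N: "\<And>k. k \<le> N \<Longrightarrow> u k = 0" using assms v in_V_iff by auto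
  define l where "l = min N (min m 0)"
  have l: "l \<le> N" "l \<le> m" "l \<le> 0" by (auto simp: l_def)
  have "(ancestor ^^ (nat (m - l) + n)) v = omega_ray (nat (- l) + n)" for n
    using l assms N by (auto simp: ancestor_pow v omega_ray_def restrict_def fun_eq_iff)
  then show ?thesis using that by blast
qed

lemma common_ancestor:
  assumes "v \<in> V" "w \<in> V"
  obtains i j where "(ancestor ^^ i) v = (ancestor ^^ j) w"
proof -
  obtain i j where 1: "\<And>n. (ancestor ^^ (i + n)) v = omega_ray (j + n)"
    using ancestor_pow_eq_omega_ray[OF assms(1)] by blast
  obtain i' j' where 2: "\<And>n. (ancestor ^^ (i' + n)) w = omega_ray (j' + n)"
    using ancestor_pow_eq_omega_ray[OF assms(2)] by blast
  show ?thesis using 1[of j'] 2[of j] that by (metis add.commute)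
qed

section \<open>Geodesics, described by the edges on them\<close>

definition below :: "vertex \<Rightarrow> vertex \<Rightarrow> bool" where
  "below a w \<longleftrightarrow> (\<exists>n. (ancestor ^^ n) a = w)"

text \<open>If the edge from \<open>w\<close> to its ancestor is removed, the vertices below
  \<open>w\<close>, including \<open>w\<close>, form one of the two sides. Hence this is the edge
  set of the geodesic from \<open>a\<close> to \<open>b\<close>.\<close>

definition sep :: "vertex \<Rightarrow> vertex \<Rightarrow> vertex set" where
  "sep a b = {w \<in> V. below a w \<noteq> below b w}"

lemma below_refl [simp]: "below a a"
  unfolding below_def by (rule exI[of _ 0]) simp

lemma below_ancestor: "below (ancestor a) w \<Longrightarrow> below a w"
  unfolding below_def by (metis funpow_Suc_right comp_apply)

lemma below_cases: "below a w \<Longrightarrow> a = w \<or> below (ancestor a) w"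
  unfolding below_def by (metis funpow_Suc_right comp_apply funpow_0 not0_implies_Suc)

lemma below_level: "below a w \<Longrightarrow> fst w \<le> fst a"
  unfolding below_def by auto

lemma below_trans: "below a b \<Longrightarrow> below b c \<Longrightarrow> below a c"
  unfolding below_def by (metis funpow_add comp_apply)

lemma below_level_eq: "below a w \<Longrightarrow> below a w' \<Longrightarrow> fst w = fst w' \<Longrightarrow> w = w'"
  unfolding below_def by auto

lemma not_ancestor_below [simp]: "\<not> below (ancestor v) v"
  using below_level by fastforce

lemma sep_self [simp]: "sep a a = {}" by (auto simp: sep_def)

lemma sep_commute: "sep a b = sep b a" by (auto simp: sep_def)

lemma sep_ancestor: "v \<in> V \<Longrightarrow> sep v (ancestor v) = {v}"
  by (auto simp: sep_def dest: below_cases intro: below_ancestor)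

lemma sep_child: "v \<in> V \<Longrightarrow> t < q \<Longrightarrow> sep v (child v t) = {child v t}"
  by (metis sep_ancestor sep_commute ancestor_child child_in_V)

text \<open>From the meeting point on, the rays from \<open>a\<close> and \<open>b\<close> towards
  the end coincide, so only vertices before it can separate.\<close>

lemma sep_subset_chains:
  assumes "(ancestor ^^ i) a = (ancestor ^^ j) b"
  shows "sep a b \<subseteq> (\<lambda>k. (ancestor ^^ k) a) ` {..<i} \<union> (\<lambda>k. (ancestor ^^ k) b) ` {..<j}"
proof -
  have *: "w \<in> (\<lambda>k. (ancestor ^^ k) a) ` {..<i}"
    if "below a w" "\<not> below b w" "(ancestor ^^ i) a = (ancestor ^^ j) b" for a b w and i j :: nat
  proof -
    obtain k where k: "(ancestor ^^ k) a = w" using \<open>below a w\<close> below_def by auto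
    have "k < i"
    proof (rule ccontr)
      assume "\<not> k < i"
      then have "(ancestor ^^ (k - i + j)) b = w"
        using k that(3) by (metis funpow_add comp_apply le_add_diff_inverse2 not_less)
      then show False using \<open>\<not> below b w\<close> below_def by blast
    qed
    then show ?thesis using k by blast
  qed
  show ?thesis using *[of a _ b i j] *[of b _ a j i] assms by (auto simp: sep_def)
qed

lemma finite_sep [simp]:
  assumes "a \<in> V" "b \<in> V" shows "finite (sep a b)"
proof -
  obtain i j where "(ancestor ^^ i) a = (ancestor ^^ j) b"
    using common_ancestor[OF assms] by blast
  from finite_subset[OF sep_subset_chains[OF this]] show ?thesis by auto
qed

text \<open>An edge is named after its lower end point. The edges at \<open>P\<close> are \<open>P\<close> itself and the children
  of \<open>P\<close>.\<close>

definition edges_at :: "vertex \<Rightarrow> vertex set" where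
  "edges_at P = insert P (child P ` {..<q})"

text \<open>This is the first edge of the geodesic from \<open>P\<close> to \<open>b\<close>: the
  edge above \<open>P\<close> if \<open>b\<close> is outside the subtree of \<open>P\<close>,
  otherwise the edge to the child through which the ray from \<open>b\<close> arrives.\<close>

lemma edge_towards:
  assumes "P \<in> V" "b \<in> V" "b \<noteq> P"
  obtains w where "w \<in> edges_at P" "w \<in> sep P b"
proof (cases "below b P")
  case False
  then show ?thesis using assms that[of P] by (auto simp: edges_at_def sep_def)
next
  case True
  then obtain n where n: "(ancestor ^^ n) b = P" using below_def by auto
  then obtain k where k: "n = Suc k" using \<open>b \<noteq> P\<close> by (cases n) auto
  define w where "w = (ancestor ^^ k) b"
  have w: "w \<in> V" "ancestor w = P" "below b w" using n k assms by (auto simp: w_def below_def)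
  then have "w = child P (snd w (fst w))" using child_ancestor by metis
  then have 1: "w \<in> edges_at P" using w last_digit_less by (auto simp: edges_at_def)
  have "\<not> below P w" using below_level[of P w] w(2) by (metis fst_ancestor not_ancestor_below)
  then show ?thesis using that[of w] 1 w by (auto simp: sep_def)
qed

lemma edge_towards_unique:
  assumes P: "P \<in> V" and "w \<in> edges_at P" "w' \<in> edges_at P" "w \<in> sep P b" "w' \<in> sep P b"
  shows "w = w'"
proof -
  have *: "w = w'" if w': "w' \<in> child P ` {..<q}" "w' \<in> sep P b"
    and w: "w \<in> edges_at P" "w \<in> sep P b" for w w'
  proof -
    have anc: "ancestor w' = P" "fst w' = fst P + 1" using w' P by auto
    have "below b w'" using w' anc by (auto simp: sep_def)
    then have "below b P" using anc below_def by (metis funpow_Suc_right comp_apply below_trans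
      below_ancestor below_refl)
    then have "w \<noteq> P" using w by (auto simp: sep_def)
    then have c: "w \<in> child P ` {..<q}" using w by (auto simp: edges_at_def)
    then have "ancestor w = P" "fst w = fst P + 1" using P by auto
    then have "below b w" using w by (auto simp: sep_def)
    then show "w = w'" using \<open>below b w'\<close> below_level_eq anc \<open>fst w = _\<close> by metis
  qed
  show ?thesis
  proof (cases "w' = P \<and> w = P")
    case False
    then have "w' \<in> child P ` {..<q} \<or> w \<in> child P ` {..<q}"
      using assms(2,3) unfolding edges_at_def by blast
    then show ?thesis using *[of w' w] *[of w w'] assms(2-) by blast
  qed simp
qed

section \<open>The affine group\<close>

text \<open>The end condition follows since the image of \<open>omega_ray\<close> is the chain of
  ancestors of \<open>g orig\<close>, and every such chain runs into
  \<open>omega_ray\<close>.\<close>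

lemma Aff_carrierI:
  assumes g: "g permutes V" and anc: "\<And>v. v \<in> V \<Longrightarrow> g (ancestor v) = ancestor (g v)"
  shows "g \<in> carrier (Aff q)"
proof -
  have gV: "g v \<in> V" if "v \<in> V" for v using permutes_in_image[OF g] that by auto
  have inj: "inj g" using g permutes_inj by auto
  have "adjacent q (g v) (g w) \<longleftrightarrow> adjacent q v w" if "v \<in> V" "w \<in> V" for v w
    using that gV anc inj unfolding adjacent_def by (metis injD)
  moreover have "same_end (g \<circ> omega_ray) omega_ray"
  proof -
    obtain i j where ij: "\<And>n. (ancestor ^^ (i + n)) (g orig) = omega_ray (j + n)"
      using ancestor_pow_eq_omega_ray[OF gV[OF omega_ray_in_V]] by blast
    have "g ((ancestor ^^ n) orig) = (ancestor ^^ n) (g orig)" for n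
      by (induction n) (auto simp: anc)
    then have "(g \<circ> omega_ray) (i + n) = omega_ray (j + n)" for n
      using ij by (metis comp_apply omega_ray_eq)
    then show ?thesis unfolding same_end_def by blast
  qed
  ultimately show ?thesis using g by (auto simp: Aff_def)
qed

lemma Aff_permutes: "g \<in> carrier (Aff q) \<Longrightarrow> g permutes V"
  by (auto simp: Aff_def)

text \<open>If \<open>g\<close> once turned an ancestor into a child, it would do so at all later
  vertices of the ray towards the end, because the parent of the image is already taken and
  \<open>g\<close> is injective. The levels of the images would then increase along this ray for
  ever. But the ray shares a tail with \<open>omega_ray\<close>, whose image finally runs along
  \<open>omega_ray\<close>, where levels decrease.\<close>

lemma Aff_ancestor:
  assumes "g \<in> carrier (Aff q)" "v \<in> V"
  shows "g (ancestor v) = ancestor (g v)"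
proof (rule ccontr)
  assume bad: "g (ancestor v) \<noteq> ancestor (g v)"
  have g: "g permutes V" and adj: "\<And>v w. v \<in> V \<Longrightarrow> w \<in> V \<Longrightarrow> adjacent q (g v) (g w) \<longleftrightarrow> adjacent q v w"
    and "same_end (g \<circ> omega_ray) omega_ray" using assms by (auto simp: Aff_def)
  then obtain i j where ij: "\<And>n. g (omega_ray (i + n)) = omega_ray (j + n)"
    by (auto simp: same_end_def)
  have inj: "inj g" using g permutes_inj by auto
  have or: "g (ancestor w) = ancestor (g w) \<or> g w = ancestor (g (ancestor w))" if "w \<in> V" for w
  proof -
    have "adjacent q (g w) (g (ancestor w))" using adj[of w "ancestor w"] that by (auto simp: adjacent_def)
    then show ?thesis by (auto simp: adjacent_def)
  qed
  have flip: "g ((ancestor ^^ n) v) = ancestor (g ((ancestor ^^ Suc n) v))" for n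
  proof (induction n)
    case 0
    then show ?case using bad or[OF assms(2)] by auto
  next
    case (Suc n)
    let ?w = "(ancestor ^^ Suc n) v"
    have "g (ancestor ?w) \<noteq> ancestor (g ?w)"
    proof
      assume "g (ancestor ?w) = ancestor (g ?w)"
      then have "g (ancestor ?w) = g ((ancestor ^^ n) v)" using Suc by simp
      then have "ancestor ?w = (ancestor ^^ n) v" using inj by (auto dest: injD)
      then have "fst (ancestor ?w) = fst ((ancestor ^^ n) v)" by simp
      then show False by simp
    qed
    then show ?case using or[of ?w] assms(2) by (metis funpow.simps(2) comp_apply ancestor_pow_in_V)
  qed
  have lev: "fst (g ((ancestor ^^ n) v)) = fst (g v) + int n" for n
  proof (induction n)
    case (Suc n)
    have "fst (g ((ancestor ^^ n) v)) = fst (g ((ancestor ^^ Suc n) v)) - 1" using flip[of n] fst_ancestor by metis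
    then show ?case using Suc by simp
  qed simp
  obtain a b where ab: "\<And>n. (ancestor ^^ (a + n)) v = omega_ray (b + n)"
    using ancestor_pow_eq_omega_ray[OF assms(2)] by blast
  have "fst (g (omega_ray (b + (i + n)))) = fst (g v) + int (a + (i + n))" for n
    using lev[of "a + (i + n)"] ab[of "i + n"] by simp
  moreover have "fst (g (omega_ray (b + (i + n)))) = - int (j + (b + n))" for n
    using ij[of "b + n"] by (simp add: ac_simps)
  ultimately have "- int (j + (b + n)) = fst (g v) + int (a + (i + n))" for n by metis
  from this[of 0] this[of 1] show False by simp
qed

lemma Aff_carrier_iff:
  "g \<in> carrier (Aff q) \<longleftrightarrow> g permutes V \<and> (\<forall>v\<in>V. g (ancestor v) = ancestor (g v))"
  using Aff_carrierI Aff_ancestor Aff_permutes by blast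

lemma Aff_in_V: "g \<in> carrier (Aff q) \<Longrightarrow> g v \<in> V \<longleftrightarrow> v \<in> V"
  using Aff_permutes permutes_in_image by metis

lemma Aff_inj: "g \<in> carrier (Aff q) \<Longrightarrow> g v = g w \<longleftrightarrow> v = w"
  using Aff_permutes permutes_inj by (metis injD)

lemma Aff_mult [simp]: "g \<otimes>\<^bsub>Aff q\<^esub> h = h \<circ> g" by (simp add: Aff_def)

lemma Aff_one [simp]: "\<one>\<^bsub>Aff q\<^esub> = id" by (simp add: Aff_def)

lemma Aff_inv_carrier:
  assumes g: "g \<in> carrier (Aff q)" shows "pinv g \<in> carrier (Aff q)"
proof (rule Aff_carrierI)
  show p: "pinv g permutes V" using g Aff_permutes permutes_inv by blast
  fix v assume v: "v \<in> V"
  have gi: "g (pinv g w) = w" for w using permutes_inverses(1)[OF Aff_permutes[OF g]] .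
  have "pinv g v \<in> V" using permutes_in_image[OF p] v by simp
  then have "g (ancestor (pinv g v)) = ancestor v" using Aff_ancestor[OF g] gi by simp
  then show "pinv g (ancestor v) = ancestor (pinv g v)"
    using permutes_inverses(2)[OF Aff_permutes[OF g]] by metis
qed

lemma Aff_inv_right: "g \<in> carrier (Aff q) \<Longrightarrow> g (pinv g v) = v"
  using permutes_inverses(1) Aff_permutes by metis

lemma Aff_inv_left: "g \<in> carrier (Aff q) \<Longrightarrow> pinv g (g v) = v"
  using permutes_inverses(2) Aff_permutes by metis

lemma Aff_comp:
  assumes "g \<in> carrier (Aff q)" "h \<in> carrier (Aff q)" shows "h \<circ> g \<in> carrier (Aff q)"
  using assms by (auto simp: Aff_carrier_iff permutes_in_image intro: permutes_compose)

lemma group_Aff: "group (Aff q)"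
proof (rule groupI)
  fix x y assume "x \<in> carrier (Aff q)" "y \<in> carrier (Aff q)"
  then show "x \<otimes>\<^bsub>Aff q\<^esub> y \<in> carrier (Aff q)"
    by (simp add: Aff_comp)
next
  fix x assume x: "x \<in> carrier (Aff q)"
  show "\<exists>y\<in>carrier (Aff q). y \<otimes>\<^bsub>Aff q\<^esub> x = \<one>\<^bsub>Aff q\<^esub>"
    using Aff_inv_carrier[OF x] Aff_inv_right[OF x] by (intro bexI[of _ "pinv x"]) (simp_all add: fun_eq_iff)
qed (auto simp: Aff_carrier_iff permutes_id comp_assoc)

lemma Aff_m_inv: "g \<in> carrier (Aff q) \<Longrightarrow> inv\<^bsub>Aff q\<^esub> g = pinv g"
  using group.inv_equality[OF group_Aff, of "pinv g" g] Aff_inv_carrier Aff_inv_right[of g]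
  by (simp add: fun_eq_iff)

lemma Aff_ancestor_pow:
  "g \<in> carrier (Aff q) \<Longrightarrow> v \<in> V \<Longrightarrow> g ((ancestor ^^ n) v) = (ancestor ^^ n) (g v)"
  by (induction n) (auto simp: Aff_ancestor)

lemma Aff_below:
  assumes "g \<in> carrier (Aff q)" "v \<in> V" shows "below (g v) (g w) \<longleftrightarrow> below v w"
  using Aff_ancestor_pow[OF assms] Aff_inj[OF assms(1)] unfolding below_def by metis

text \<open>On \<open>V\<close> this is the portrait of \<open>g\<close>, by \<open>portrait_eq\<close> below.\<close>

definition lp :: "(vertex \<Rightarrow> vertex) \<Rightarrow> vertex \<Rightarrow> nat \<Rightarrow> nat" where
  "lp g v t = (if t < q then snd (g (child v t)) (fst (g (child v t))) else t)"

lemma Aff_child: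
  assumes g: "g \<in> carrier (Aff q)" and "v \<in> V" "t < q"
  shows "g (child v t) = child (g v) (lp g v t)"
  using assms child_ancestor[of "g (child v t)"] Aff_ancestor[OF g, of "child v t"]
  by (simp add: lp_def Aff_in_V[OF g])

lemma lp_less: "g \<in> carrier (Aff q) \<Longrightarrow> v \<in> V \<Longrightarrow> t < q \<Longrightarrow> lp g v t < q"
  using last_digit_less[of "g (child v t)"] Aff_in_V[of g "child v t"] by (simp add: lp_def)

lemma lp_unique:
  assumes "g \<in> carrier (Aff q)" "v \<in> V" "\<sigma> permutes {..<q}"
    "\<And>t. t < q \<Longrightarrow> g (child v t) = child (g v) (\<sigma> t)"
  shows "lp g v = \<sigma>"
proof
  fix t
  show "lp g v t = \<sigma> t"
  proof (cases "t < q")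
    case True
    then show ?thesis using assms(2,4) Aff_child[OF assms(1,2), of t] Aff_in_V[OF assms(1), of v] by simp
  next
    case False
    then show ?thesis using assms(3) by (simp add: lp_def permutes_def)
  qed
qed

lemma lp_permutes:
  assumes g: "g \<in> carrier (Aff q)" and v: "v \<in> V"
  shows "lp g v permutes {..<q}"
proof (rule bij_imp_permutes)
  have "inj_on (lp g v) {..<q}"
  proof (rule inj_onI)
    fix s t assume st: "s \<in> {..<q}" "t \<in> {..<q}" "lp g v s = lp g v t"
    then have "g (child v s) = g (child v t)" using Aff_child[OF g v] by simp
    then show "s = t" using Aff_inj[OF g, of "child v s" "child v t"] v by simp
  qed
  moreover have "lp g v ` {..<q} \<subseteq> {..<q}" using lp_less[OF g v] by auto
  ultimately show "bij_betw (lp g v) {..<q} {..<q}"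
    by (simp add: bij_betw_def endo_inj_surj)
qed (simp add: lp_def)

lemma lp_mult:
  assumes "g \<in> carrier (Aff q)" "h \<in> carrier (Aff q)" "v \<in> V"
  shows "lp (h \<circ> g) v = lp h (g v) \<circ> lp g v"
proof (rule lp_unique)
  show "h \<circ> g \<in> carrier (Aff q)" by (rule Aff_comp[OF assms(1,2)])
  show "lp h (g v) \<circ> lp g v permutes {..<q}"
    using assms by (intro permutes_compose lp_permutes) (auto simp: Aff_in_V[OF assms(1)])
  show "(h \<circ> g) (child v t) = child ((h \<circ> g) v) ((lp h (g v) \<circ> lp g v) t)" if "t < q" for t
    using assms that lp_less[of g v t] Aff_child[of g v t] Aff_child[of h "g v" "lp g v t"]
      Aff_in_V[OF assms(1), of v] by simp
qed (use assms in auto)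

lemma lp_id [simp]: "v \<in> V \<Longrightarrow> lp id v = id"
  by (auto simp: lp_def fun_eq_iff)

lemma lp_inv:
  assumes g: "g \<in> carrier (Aff q)" and v: "v \<in> V"
  shows "lp (pinv g) v = pinv (lp g (pinv g v))"
proof -
  have i: "pinv g \<in> carrier (Aff q)" using Aff_inv_carrier[OF g] .
  then have iv: "pinv g v \<in> V" using v Aff_in_V by blast
  have "g \<circ> pinv g = id" using Aff_inv_right[OF g] by (simp add: fun_eq_iff)
  then have "lp g (pinv g v) \<circ> lp (pinv g) v = id" using lp_mult[OF i g v] v by simp
  then have "lp g (pinv g v) (lp (pinv g) v t) = t" for t by (simp add: fun_eq_iff)
  then show ?thesis using permutes_inv_eq[OF lp_permutes[OF g iv]] by (metis ext)
qed

section \<open>Portraits\<close>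

text \<open>These are the integer powers of \<open>shift q\<close> (\<open>shift_int_pow\<close>),
  in a form that makes inverses explicit.\<close>

definition shift_by :: "int \<Rightarrow> vertex \<Rightarrow> vertex" where
  "shift_by m v = (if v \<in> V then (fst v + m, \<lambda>k. snd v (k - m)) else v)"

lemma shift_by_in_V: "v \<in> V \<Longrightarrow> shift_by m v \<in> V"
proof (cases v)
  case (Pair n u)
  assume v: "v \<in> V"
  then obtain N where N: "\<forall>k\<le>N. u k = 0" using Pair in_V_iff by auto
  then have "\<forall>k\<le>N+m. u (k - m) = 0" by auto
  then show ?thesis using v Pair by (auto simp: in_V_iff shift_by_def)
qed

lemma shift_by_add: "shift_by m (shift_by n v) = shift_by (m + n) v"
  using shift_by_in_V[of v n] by (auto simp: shift_by_def algebra_simps)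

lemma shift_by_0 [simp]: "shift_by 0 = id" by (auto simp: shift_by_def)

lemma shift_by_Aff: "shift_by m \<in> carrier (Aff q)"
proof (rule Aff_carrierI)
  have "bij (shift_by m)" by (rule o_bij[of "shift_by (- m)"]) (auto simp: fun_eq_iff shift_by_add)
  moreover have "\<forall>v. v \<notin> V \<longrightarrow> shift_by m v = v" by (simp add: shift_by_def)
  ultimately show "shift_by m permutes V" unfolding permutes_def bij_iff by blast
  fix v assume "v \<in> V"
  then show "shift_by m (ancestor v) = ancestor (shift_by m v)"
    using ancestor_in_V[of v] by (auto simp: shift_by_def ancestor_def restrict_def fun_eq_iff)
qed

lemma lp_shift_by [simp]: "v \<in> V \<Longrightarrow> lp (shift_by m) v = id"
  using child_in_V[of v] by (auto simp: lp_def fun_eq_iff shift_by_def)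

lemma shift_eq_shift_by: "shift q = shift_by 1"
  by (auto simp: shift_def shift_by_def fun_eq_iff)

lemma shift_int_pow: "shift q [^]\<^bsub>Aff q\<^esub> (m::int) = shift_by m"
proof -
  interpret A: group "Aff q" by (rule group_Aff)
  have nat: "shift q [^]\<^bsub>Aff q\<^esub> (n::nat) = shift_by (int n)" for n
    by (induction n) (auto simp: fun_eq_iff shift_eq_shift_by shift_by_add)
  have inv: "inv\<^bsub>Aff q\<^esub> (shift_by n) = shift_by (- n)" for n
    using A.inv_equality[of "shift_by (- n)" "shift_by n"] shift_by_Aff
    by (auto simp: fun_eq_iff shift_by_add)
  show ?thesis
    by (auto simp: int_pow_def2 nat inv)
qed

lemma hor_portrait_eq:
  assumes "g \<in> carrier (Aff q)" "v \<in> V" shows "hor_portrait q g v = lp g v"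
  unfolding hor_portrait_def
proof (rule the_equality)
  show "lp g v permutes {..<q} \<and> (\<forall>t<q. g (child v t) = child (g v) (lp g v t))"
    using lp_permutes[OF assms] Aff_child[OF assms] by blast
  fix \<sigma> assume "\<sigma> permutes {..<q} \<and> (\<forall>t<q. g (child v t) = child (g v) (\<sigma> t))"
  then show "\<sigma> = lp g v" using lp_unique[OF assms, of \<sigma>] by simp
qed

lemma fst_Aff_shift: "fst (shift_by m v) = fst v + m" if "v \<in> V" 
  using that by (simp add: shift_by_def)

lemma hor_part_eq:
  assumes g: "g \<in> carrier (Aff q)"
  shows "hor_part q g = shift_by (- Phi g) \<circ> g"
  unfolding hor_part_def shift_int_pow
proof (rule the_equality)
  have "g orig \<in> V" using Aff_in_V[OF g] by simp
  then have "shift_by (- Phi g) \<circ> g \<in> Hor q"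
    using Aff_comp[OF g shift_by_Aff[of "- Phi g"]]
    by (simp add: Hor_def Phi_def level_def fst_Aff_shift)
  moreover have "g = shift_by (Phi g) \<circ> (shift_by (- Phi g) \<circ> g)"
    by (auto simp: fun_eq_iff shift_by_add)
  ultimately show "shift_by (- Phi g) \<circ> g \<in> Hor q \<and>
      (\<exists>m. g = (shift_by (- Phi g) \<circ> g) \<otimes>\<^bsub>Aff q\<^esub> shift_by m)" by auto
  fix h assume "h \<in> Hor q \<and> (\<exists>m. g = h \<otimes>\<^bsub>Aff q\<^esub> shift_by m)"
  then obtain m where h: "h \<in> carrier (Aff q)" "Phi h = 0" and gm: "g = shift_by m \<circ> h"
    by (auto simp: Hor_def)
  have "m = Phi g" using h Aff_in_V[OF h(1), of orig] by (simp add: gm Phi_def level_def fst_Aff_shift)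
  then show "h = shift_by (- Phi g) \<circ> g"
    by (subst (2) gm) (auto simp: fun_eq_iff shift_by_add)
qed

text \<open>The horocyclic part is \<open>g\<close> followed by a shift, and shifts have trivial
  local permutations.\<close>

lemma portrait_eq:
  assumes g: "g \<in> carrier (Aff q)" and v: "v \<in> V" shows "portrait q g v = lp g v"
proof -
  have "shift_by (- Phi g) \<circ> g \<in> carrier (Aff q)"
    using Aff_comp[OF g shift_by_Aff[of "- Phi g"]] by simp
  then show ?thesis using g v Aff_in_V[OF g, of v]
    by (simp add: portrait_def hor_part_eq hor_portrait_eq lp_mult shift_by_Aff)
qed

end

section \<open>The discrete affine group\<close>

context regular_tree
begin

lemma DA_carrier: "x \<in> carrier (DA q) \<longleftrightarrow> x \<in> carrier (Aff q) \<and> finite {v \<in> V. lp x v \<noteq> id}"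
proof -
  have "{v \<in> V. portrait q x v \<noteq> id} = {v \<in> V. lp x v \<noteq> id}" if "x \<in> carrier (Aff q)"
    using portrait_eq[OF that] by auto
  then show ?thesis by (auto simp: DA_def)
qed

lemma DA_Aff: "x \<in> carrier (DA q) \<Longrightarrow> x \<in> carrier (Aff q)"
  by (simp add: DA_carrier)

lemma DA_mult [simp]: "x \<otimes>\<^bsub>DA q\<^esub> y = y \<circ> x"
  by (simp add: DA_def Aff_def)

lemma DA_one [simp]: "\<one>\<^bsub>DA q\<^esub> = id"
  by (simp add: DA_def Aff_def)

text \<open>By \<open>lp_mult\<close> and \<open>lp_inv\<close>, the support of an inverse is
  contained in a translate of a finite support, and that of a product in the union of one finite
  support and a translate of the other.\<close>

lemma subgroup_DA: "subgroup (carrier (DA q)) (Aff q)"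
proof (rule group.subgroupI[OF group_Aff])
  show "carrier (DA q) \<subseteq> carrier (Aff q)" using DA_Aff by blast
  have "{v \<in> V. lp id v \<noteq> id} = {}" using lp_id by blast
  then have "\<one>\<^bsub>Aff q\<^esub> \<in> carrier (DA q)"
    using monoid.one_closed[OF group.is_monoid[OF group_Aff]] unfolding DA_carrier Aff_one
    by (metis finite.emptyI)
  then show "carrier (DA q) \<noteq> {}" by blast
next
  fix g assume "g \<in> carrier (DA q)"
  then have g: "g \<in> carrier (Aff q)" and fin: "finite {v \<in> V. lp g v \<noteq> id}" by (auto simp: DA_carrier)
  have "{v \<in> V. lp (pinv g) v \<noteq> id} \<subseteq> g ` {v \<in> V. lp g v \<noteq> id}"
  proof
    fix v assume v: "v \<in> {v \<in> V. lp (pinv g) v \<noteq> id}"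
    then have "pinv g v \<in> V" using Aff_in_V[OF Aff_inv_carrier[OF g]] by auto
    moreover have "lp g (pinv g v) \<noteq> id" using v lp_inv[OF g, of v] by (auto simp: inv_id)
    ultimately show "v \<in> g ` {v \<in> V. lp g v \<noteq> id}"
      using Aff_inv_right[OF g, of v] by (metis (mono_tags, lifting) image_eqI mem_Collect_eq)
  qed
  then show "inv\<^bsub>Aff q\<^esub> g \<in> carrier (DA q)"
    using fin Aff_inv_carrier[OF g] by (simp add: Aff_m_inv[OF g] DA_carrier finite_subset)
next
  fix g h assume "g \<in> carrier (DA q)" "h \<in> carrier (DA q)"
  then have g: "g \<in> carrier (Aff q)" "finite {v \<in> V. lp g v \<noteq> id}"
    and h: "h \<in> carrier (Aff q)" "finite {v \<in> V. lp h v \<noteq> id}" by (auto simp: DA_carrier)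
  have "{v \<in> V. lp (h \<circ> g) v \<noteq> id} \<subseteq> {v \<in> V. lp g v \<noteq> id} \<union> pinv g ` {v \<in> V. lp h v \<noteq> id}"
  proof
    fix v assume v: "v \<in> {v \<in> V. lp (h \<circ> g) v \<noteq> id}"
    then have "lp h (g v) \<noteq> id \<or> lp g v \<noteq> id" using lp_mult[OF g(1) h(1), of v] by auto
    moreover have "g v \<in> V" "v = pinv g (g v)" using v Aff_in_V[OF g(1)] Aff_inv_left[OF g(1)] by auto
    ultimately show "v \<in> {v \<in> V. lp g v \<noteq> id} \<union> pinv g ` {v \<in> V. lp h v \<noteq> id}"
      using v by blast
  qed
  then have "finite {v \<in> V. lp (h \<circ> g) v \<noteq> id}"
    using g h by (meson finite_UnI finite_imageI finite_subset)
  then show "g \<otimes>\<^bsub>Aff q\<^esub> h \<in> carrier (DA q)"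
    using Aff_comp[OF g(1) h(1)] by (simp add: DA_carrier)
qed

lemma DA_eq: "DA q = (Aff q)\<lparr>carrier := carrier (DA q)\<rparr>"
  by (simp add: DA_def)

lemma group_DA: "group (DA q)"
  using subgroup.subgroup_is_group[OF subgroup_DA group_Aff] DA_eq by simp

lemma DA_m_inv: "x \<in> carrier (DA q) \<Longrightarrow> inv\<^bsub>DA q\<^esub> x = pinv x"
  using group.m_inv_consistent[OF group_Aff subgroup_DA, of x] DA_eq Aff_m_inv[OF DA_Aff, of x] by simp

lemma DA_comp: "x \<in> carrier (DA q) \<Longrightarrow> y \<in> carrier (DA q) \<Longrightarrow> y \<circ> x \<in> carrier (DA q)"
  using monoid.m_closed[OF group.is_monoid[OF group_DA], of x y] by simp

lemma shift_by_DA: "shift_by m \<in> carrier (DA q)"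
proof -
  have "{v \<in> V. lp (shift_by m) v \<noteq> id} = {}" by auto
  then show ?thesis using shift_by_Aff[of m] unfolding DA_carrier by (metis finite.emptyI)
qed

text \<open>\<open>A\<close> is meant to consist of vertices of level 0, and \<open>(0, restrict (snd v) {..0})\<close> is the
  ancestor of \<open>v\<close> at level 0.\<close>

definition rot :: "vertex set \<Rightarrow> (nat \<Rightarrow> nat) \<Rightarrow> vertex \<Rightarrow> vertex" where
  "rot A \<sigma> v = (if v \<in> V \<and> 1 \<le> fst v \<and> (0, restrict (snd v) {..0}) \<in> A
     then (fst v, (snd v)(1 := \<sigma> (snd v 1))) else v)"

lemma rot_in_V:
  assumes "\<sigma> permutes {..<q}" "v \<in> V" shows "rot A \<sigma> v \<in> V"
proof (cases v)
  case (Pair m u)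
  then obtain N where N: "\<forall>k\<le>N. u k = 0" and u: "\<forall>k\<le>m. u k < q" "\<forall>k>m. u k = undefined"
    using assms(2) in_V_iff by auto
  show ?thesis
  proof (cases "1 \<le> m")
    case True
    have "\<forall>k\<le>min N 0. (u(1 := \<sigma> (u 1))) k = 0" using N by auto
    then have "\<exists>N. \<forall>k\<le>N. (u(1 := \<sigma> (u 1))) k = 0" by blast
    moreover have "\<sigma> (u 1) < q" using permutes_in_image[OF assms(1), of "u 1"] u True by simp
    ultimately show ?thesis using u True Pair assms(2) by (simp add: in_V_iff rot_def)
  qed (use Pair assms(2) in \<open>simp add: rot_def\<close>)
qed

lemma rot_rot:
  assumes "\<tau> permutes {..<q}" shows "rot A \<sigma> (rot A \<tau> v) = rot A (\<sigma> \<circ> \<tau>) v"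
proof -
  have "restrict (u(1 := x)) {..0} = restrict u {..0}" for u :: "int \<Rightarrow> nat" and x
    by (auto simp: restrict_def fun_eq_iff)
  then show ?thesis using rot_in_V[OF assms, of v A] by (auto simp: rot_def)
qed

lemma rot_id: "rot A id = id"
  by (auto simp: rot_def fun_eq_iff)

lemma rot_Aff:
  assumes \<sigma>: "\<sigma> permutes {..<q}" shows "rot A \<sigma> \<in> carrier (Aff q)"
proof (rule Aff_carrierI)
  have "bij (rot A \<sigma>)"
  proof (rule o_bij[of "rot A (pinv \<sigma>)"])
    have "rot A (pinv \<sigma>) (rot A \<sigma> v) = v" "rot A \<sigma> (rot A (pinv \<sigma>) v) = v" for v
      by (metis rot_rot[OF \<sigma>] permutes_inv_o(2)[OF \<sigma>] rot_id id_apply)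
         (metis rot_rot[OF permutes_inv[OF \<sigma>]] permutes_inv_o(1)[OF \<sigma>] rot_id id_apply)
    then show "rot A (pinv \<sigma>) \<circ> rot A \<sigma> = id" "rot A \<sigma> \<circ> rot A (pinv \<sigma>) = id"
      by (simp_all add: fun_eq_iff)
  qed
  moreover have "\<forall>v. v \<notin> V \<longrightarrow> rot A \<sigma> v = v" by (simp add: rot_def)
  ultimately show "rot A \<sigma> permutes V" unfolding permutes_def bij_iff by blast
  fix v assume v: "v \<in> V"
  obtain m u where mu: "v = (m, u)" by (cases v)
  have un: "\<forall>k>m. u k = undefined" using v mu in_V_iff by auto
  have r: "restrict (restrict u {..m - 1}) {..0} = restrict u {..0}" if "1 \<le> m"
    using that by (auto simp: restrict_def fun_eq_iff)
  consider "m < 1" | "m = 1" | "1 < m" by linarith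
  then show "rot A \<sigma> (ancestor v) = ancestor (rot A \<sigma> v)"
  proof cases
    case 2
    then show ?thesis by (auto simp: rot_def ancestor_def mu restrict_def fun_eq_iff)
  next
    case 3
    then show ?thesis using r v ancestor_in_V[OF v]
      by (auto simp: rot_def ancestor_def mu restrict_def fun_eq_iff)
  qed (auto simp: rot_def mu ancestor_def)
qed

text \<open>The digit at place 1 is the last digit only for children of vertices of level 0; at all
  other vertices the last digit of a child is copied.\<close>

lemma lp_rot:
  assumes \<sigma>: "\<sigma> permutes {..<q}" and A: "\<And>a. a \<in> A \<Longrightarrow> fst a = 0" and v: "v \<in> V"
  shows "lp (rot A \<sigma>) v = (if v \<in> A then \<sigma> else id)"
proof
  fix t
  obtain m u where mu: "v = (m, u)" by (cases v)
  have un: "\<forall>k>m. u k = undefined" using v mu in_V_iff by auto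
  have r: "restrict (u(1 := t)) {..0} = u" if "m = 0"
    using that un by (auto simp: restrict_def fun_eq_iff)
  show "lp (rot A \<sigma>) v t = (if v \<in> A then \<sigma> else id) t"
  proof (cases "t < q")
    case t: True
    have c: "child v t \<in> V" using v t by simp
    consider "m < 0" | "m = 0" | "0 < m" by linarith
    then show ?thesis
    proof cases
      case 1
      then show ?thesis using t A[of v] by (auto simp: lp_def rot_def mu child_def)
    next
      case 2
      then show ?thesis using t r c by (auto simp: lp_def rot_def mu child_def)
    next
      case 3
      then show ?thesis using t A[of v] by (auto simp: lp_def rot_def mu child_def)
    qed
  next
    case False
    then show ?thesis using \<sigma> by (simp add: lp_def permutes_def)
  qed
qed

lemma rot_DA:
  assumes "\<sigma> permutes {..<q}" "\<And>a. a \<in> A \<Longrightarrow> fst a = 0" "finite A"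
  shows "rot A \<sigma> \<in> carrier (DA q)"
proof -
  have "{v \<in> V. lp (rot A \<sigma>) v \<noteq> id} \<subseteq> A" using lp_rot[OF assms(1,2)] by auto
  then show ?thesis using rot_Aff[OF assms(1)] assms(3) by (auto simp: DA_carrier intro: finite_subset)
qed

lemma rot_orig [simp]: "rot A \<sigma> orig = orig"
  by (simp add: rot_def)

section \<open>Positions and how the generators move them\<close>

definition pos :: "(vertex \<Rightarrow> vertex) \<Rightarrow> vertex" where
  "pos x = pinv x orig"

lemma pos_in_V: "x \<in> carrier (Aff q) \<Longrightarrow> pos x \<in> V"
  using Aff_in_V[OF Aff_inv_carrier] by (simp add: pos_def)

lemma apply_pos: "x \<in> carrier (Aff q) \<Longrightarrow> x (pos x) = orig"
  using Aff_inv_right by (simp add: pos_def)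

lemma pos_eqI: "x \<in> carrier (Aff q) \<Longrightarrow> x v = orig \<Longrightarrow> pos x = v"
  using Aff_inv_left by (metis pos_def)

text \<open>The position determines the images of its ancestors. Every vertex hangs below one of
  these, and the local permutations determine its image digit by digit.\<close>

lemma Aff_eqI:
  assumes x: "x \<in> carrier (Aff q)" and y: "y \<in> carrier (Aff q)"
    and "pos x = pos y" and lp: "\<And>v. v \<in> V \<Longrightarrow> lp x v = lp y v"
  shows "x = y"
proof
  fix v
  have down: "x v = y v" if "x ((ancestor ^^ i) v) = y ((ancestor ^^ i) v)" "v \<in> V" for i v
    using that
  proof (induction i arbitrary: v)
    case (Suc i)
    then have "x (ancestor v) = y (ancestor v)" by (simp add: funpow_swap1)
    then show ?case
      using Suc.prems(2) lp[of "ancestor v"] child_ancestor[of v] last_digit_less[of v]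
        Aff_child[OF x, of "ancestor v" "snd v (fst v)"] Aff_child[OF y, of "ancestor v" "snd v (fst v)"]
      by simp
  qed simp
  show "x v = y v"
  proof (cases "v \<in> V")
    case True
    obtain i j where ij: "(ancestor ^^ i) v = (ancestor ^^ j) (pos x)"
      using common_ancestor[OF True pos_in_V[OF x]] by blast
    have "x ((ancestor ^^ j) (pos x)) = y ((ancestor ^^ j) (pos x))"
      using Aff_ancestor_pow[OF x pos_in_V[OF x]] Aff_ancestor_pow[OF y pos_in_V[OF y]]
        apply_pos[OF x] apply_pos[OF y] assms(3) by simp
    then show ?thesis using down[of i v] ij True by simp
  next
    case False
    then show ?thesis using permutes_not_in[OF Aff_permutes[OF x]] permutes_not_in[OF Aff_permutes[OF y]] by metis
  qed
qed

lemma pos_comp: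
  assumes "x \<in> carrier (Aff q)" "y \<in> carrier (Aff q)"
  shows "pos (y \<circ> x) = pinv x (pos y)"
  using assms by (intro pos_eqI) (simp_all add: Aff_comp apply_pos Aff_inv_right)

lemma pos_comp_rot:
  assumes x: "x \<in> carrier (Aff q)" and \<sigma>: "\<sigma> permutes {..<q}"
  shows "pos (rot {orig} \<sigma> \<circ> x) = pos x"
  using Aff_comp[OF x rot_Aff[OF \<sigma>]] by (intro pos_eqI) (simp_all add: apply_pos[OF x])

text \<open>The factor applied last acts at \<open>x v\<close>, which is the root only for
  \<open>v = pos x\<close>. So right multiplication by a rotation is felt at the position
  alone.\<close>

lemma lp_comp_rot:
  assumes x: "x \<in> carrier (Aff q)" and \<sigma>: "\<sigma> permutes {..<q}" and v: "v \<in> V"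
  shows "lp (rot {orig} \<sigma> \<circ> x) v = (if v = pos x then \<sigma> \<circ> lp x v else lp x v)"
proof -
  have "x v = orig \<longleftrightarrow> v = pos x" using apply_pos[OF x] Aff_inj[OF x] by metis
  moreover have "x v \<in> V" using Aff_in_V[OF x] v by simp
  ultimately show ?thesis using lp_mult[OF x rot_Aff[OF \<sigma>] v] lp_rot[OF \<sigma>, of "{orig}" "x v"] by simp
qed

lemma lp_comp_shift:
  assumes x: "x \<in> carrier (Aff q)" and v: "v \<in> V"
  shows "lp (shift_by m \<circ> x) v = lp x v"
  using lp_mult[OF x shift_by_Aff v] Aff_in_V[OF x, of v] v by simp

lemma shift_by_up: "shift_by 1 (ancestor orig) = orig"
  using ancestor_in_V[OF omega_ray_in_V, of 0]
  by (auto simp: shift_by_def omega_ray_def ancestor_def restrict_def fun_eq_iff)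

lemma shift_by_down: "shift_by (- 1) (child orig 0) = orig"
  using child_in_V[OF omega_ray_in_V, of 0 0] q2
  by (auto simp: shift_by_def omega_ray_def child_def restrict_def fun_eq_iff)

lemma pos_comp_shift_up:
  assumes x: "x \<in> carrier (Aff q)" shows "pos (shift_by 1 \<circ> x) = ancestor (pos x)"
  using Aff_comp[OF x shift_by_Aff]
  by (intro pos_eqI) (simp_all add: Aff_ancestor[OF x pos_in_V[OF x]] apply_pos[OF x] shift_by_up)

text \<open>The inverse shift brings the child of the root with digit 0 to the root. Hence only the
  child that the local permutation sends to 0 can be reached directly.\<close>

lemma pos_comp_shift_down:
  assumes x: "x \<in> carrier (Aff q)" and t: "t < q" "lp x (pos x) t = 0"
  shows "pos (shift_by (- 1) \<circ> x) = child (pos x) t"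
  using Aff_comp[OF x shift_by_Aff] t
  by (intro pos_eqI) (simp_all add: Aff_child[OF x pos_in_V[OF x]] apply_pos[OF x] shift_by_down)

section \<open>The edges on which two elements differ\<close>

text \<open>\<open>view x w\<close> records on which side of the edge \<open>w\<close> the vertex \<open>pos x\<close> lies, and the portrait of
  \<open>x\<close> on the other side.\<close>

definition view :: "(vertex \<Rightarrow> vertex) \<Rightarrow> vertex \<Rightarrow> bool \<times> (vertex \<Rightarrow> nat \<Rightarrow> nat)" where
  "view x w = (below (pos x) w,
     \<lambda>v. if v \<in> V \<and> below v w \<noteq> below (pos x) w then lp x v else id)"

definition diff_edges :: "(vertex \<Rightarrow> vertex) \<Rightarrow> (vertex \<Rightarrow> vertex) \<Rightarrow> vertex set" where
  "diff_edges x y = {w \<in> V. view x w \<noteq> view y w}"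

definition diff_lp :: "(vertex \<Rightarrow> vertex) \<Rightarrow> (vertex \<Rightarrow> vertex) \<Rightarrow> vertex set" where
  "diff_lp x y = {v \<in> V. lp x v \<noteq> lp y v}"

text \<open>If \<open>w\<close> separates the positions, the first components of the views differ.
  Otherwise both views show the same far side, and they differ iff some \<open>b\<close> there has
  different local permutations, that is, iff \<open>w\<close> is on the geodesic from
  \<open>pos x\<close> to such a \<open>b\<close>. The union of these geodesics is the spanned
  subtree.\<close>

lemma diff_edges_eq: "diff_edges x y = (\<Union>b\<in>insert (pos y) (diff_lp x y). sep (pos x) b)"
proof -
  have "view x w \<noteq> view y w \<longleftrightarrow> (\<exists>b\<in>insert (pos y) (diff_lp x y). w \<in> sep (pos x) b)" if "w \<in> V" for w
  proof (cases "below (pos x) w = below (pos y) w")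
    case True
    then show ?thesis using that by (auto simp: view_def diff_lp_def sep_def fun_eq_iff)
  next
    case False
    then show ?thesis using that by (auto simp: view_def sep_def)
  qed
  then show ?thesis by (auto simp: diff_edges_def sep_def)
qed

lemma diff_edges_triangle: "diff_edges x z \<subseteq> diff_edges x y \<union> diff_edges y z"
  by (auto simp: diff_edges_def)

lemma diff_edges_commute: "diff_edges x y = diff_edges y x"
  by (auto simp: diff_edges_def)

lemma finite_diff_edges:
  assumes "x \<in> carrier (DA q)" "y \<in> carrier (DA q)" shows "finite (diff_edges x y)"
proof -
  have "diff_lp x y \<subseteq> {v \<in> V. lp x v \<noteq> id} \<union> {v \<in> V. lp y v \<noteq> id}" by (auto simp: diff_lp_def)
  then have "finite (diff_lp x y)" using assms by (auto simp: DA_carrier dest: finite_subset)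
  moreover have "diff_lp x y \<subseteq> V" by (auto simp: diff_lp_def)
  ultimately show ?thesis
    using assms pos_in_V[OF DA_Aff] unfolding diff_edges_eq
    by (intro finite_UN_I finite_sep) auto
qed

lemma Aff_sep:
  assumes g: "g \<in> carrier (Aff q)" and ab: "a \<in> V" "b \<in> V"
  shows "sep (g a) (g b) = g ` sep a b"
proof -
  have "w \<in> sep (g a) (g b) \<longleftrightarrow> w \<in> g ` sep a b" for w
  proof -
    have w: "w = g (pinv g w)" using Aff_inv_right[OF g] by simp
    have "w \<in> sep (g a) (g b) \<longleftrightarrow> pinv g w \<in> sep a b"
      unfolding sep_def using Aff_below[OF g ab(1), of "pinv g w"] Aff_below[OF g ab(2), of "pinv g w"]
        w Aff_in_V[OF g, of "pinv g w"] by simp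
    also have "\<dots> \<longleftrightarrow> w \<in> g ` sep a b"
      using w Aff_inv_left[OF g] by (metis image_iff)
    finally show ?thesis .
  qed
  then show ?thesis by blast
qed

text \<open>By \<open>lp_mult\<close> the same bijection \<open>lp z v\<close> is composed on the
  right of both local permutations, so it cancels.\<close>

lemma diff_lp_comp:
  assumes z: "z \<in> carrier (Aff q)" and x: "x \<in> carrier (Aff q)" and y: "y \<in> carrier (Aff q)"
  shows "diff_lp (x \<circ> z) (y \<circ> z) = pinv z ` diff_lp x y"
proof -
  have "v \<in> diff_lp (x \<circ> z) (y \<circ> z) \<longleftrightarrow> z v \<in> diff_lp x y" for v
  proof (cases "v \<in> V")
    case True
    then have "inj (lp z v)" "z v \<in> V" "surj (lp z v)"
      using permutes_inj[OF lp_permutes[OF z]] permutes_surj[OF lp_permutes[OF z]] Aff_in_V[OF z] by auto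
    then show ?thesis using True lp_mult[OF z x True] lp_mult[OF z y True]
      by (auto simp: diff_lp_def fun_eq_iff) (metis surjD)
  next
    case False
    then show ?thesis using Aff_in_V[OF z] by (auto simp: diff_lp_def)
  qed
  moreover have "z v \<in> D \<longleftrightarrow> v \<in> pinv z ` D" for v D
  proof
    assume "z v \<in> D"
    then show "v \<in> pinv z ` D" using Aff_inv_left[OF z, of v] by (intro image_eqI[of v "pinv z" "z v"]) simp_all
  next
    assume "v \<in> pinv z ` D"
    then obtain u where "u \<in> D" "v = pinv z u" by blast
    then show "z v \<in> D" using Aff_inv_right[OF z, of u] by simp
  qed
  ultimately show ?thesis by blast
qed

text \<open>\<open>x \<circ> z\<close> is the left translate of \<open>x\<close> by
  \<open>z\<close>. Positions and portraits are transported by \<open>pinv z\<close> alike, so the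
  number of differing edges is left invariant, as the word metric is.\<close>

lemma diff_edges_comp:
  assumes z: "z \<in> carrier (Aff q)" and x: "x \<in> carrier (Aff q)" and y: "y \<in> carrier (Aff q)"
  shows "diff_edges (x \<circ> z) (y \<circ> z) = pinv z ` diff_edges x y"
proof -
  have "b \<in> V" if "b \<in> insert (pos y) (diff_lp x y)" for b
    using that pos_in_V[OF y] by (auto simp: diff_lp_def)
  then have "sep (pinv z (pos x)) (pinv z b) = pinv z ` sep (pos x) b" if "b \<in> insert (pos y) (diff_lp x y)" for b
    using that Aff_sep[OF Aff_inv_carrier[OF z] pos_in_V[OF x]] by blast
  then show ?thesis
    by (simp add: diff_edges_eq pos_comp[OF z x] pos_comp[OF z y] diff_lp_comp[OF z x y] image_Un image_UN)
qed

lemma card_diff_edges_comp: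
  assumes z: "z \<in> carrier (Aff q)" and x: "x \<in> carrier (Aff q)" and y: "y \<in> carrier (Aff q)"
  shows "card (diff_edges (x \<circ> z) (y \<circ> z)) = card (diff_edges x y)"
proof -
  have "inj (pinv z)" using Aff_inj[OF Aff_inv_carrier[OF z]] by (auto intro: injI)
  then show ?thesis unfolding diff_edges_comp[OF assms] by (intro card_image) (auto intro: inj_on_subset)
qed

section \<open>Word length and differing edges\<close>

text \<open>The walk is made with these elements, whereas the word metric may belong to another
  generating set; the link is a bound for their lengths in that metric.\<close>

definition gens :: "(vertex \<Rightarrow> vertex) set" where
  "gens = {shift_by 1, shift_by (- 1)} \<union> rot {orig} ` {\<sigma>. \<sigma> permutes {..<q}}"

lemma finite_gens: "finite gens"
  by (simp add: gens_def finite_permutations)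

lemma gens_DA: "t \<in> gens \<Longrightarrow> t \<in> carrier (DA q)"
  by (auto simp: gens_def intro!: shift_by_DA rot_DA)

lemma rot_gens: "\<sigma> permutes {..<q} \<Longrightarrow> rot {orig} \<sigma> \<in> gens"
  by (auto simp: gens_def)

lemma adjust_lp:
  assumes x: "x \<in> carrier (Aff q)" and M: "M permutes {..<q}"
  obtains t where "t \<in> gens" "pos (t \<circ> x) = pos x"
    "\<And>v. v \<in> V \<Longrightarrow> lp (t \<circ> x) v = (if v = pos x then M else lp x v)"
proof -
  have p: "lp x (pos x) permutes {..<q}" using lp_permutes[OF x pos_in_V[OF x]] .
  define \<sigma> where "\<sigma> = M \<circ> pinv (lp x (pos x))"
  have \<sigma>: "\<sigma> permutes {..<q}" unfolding \<sigma>_def using permutes_compose[OF permutes_inv[OF p] M] .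
  have "\<sigma> \<circ> lp x (pos x) = M" using permutes_inv_o(2)[OF p] by (simp add: \<sigma>_def comp_assoc)
  then show ?thesis using that[of "rot {orig} \<sigma>"] rot_gens[OF \<sigma>] pos_comp_rot[OF x \<sigma>] lp_comp_rot[OF x \<sigma>]
    by simp
qed

text \<open>A rotation installs \<open>M\<close> at the position, then a shift crosses the edge. By
  \<open>pos_comp_shift_down\<close> a descent needs an \<open>M\<close> that sends the chosen child
  to 0.\<close>

lemma cross_edge:
  assumes x: "x \<in> carrier (Aff q)" and w: "w \<in> edges_at (pos x)" and M: "M permutes {..<q}"
    and M0: "\<And>t. t < q \<Longrightarrow> w = child (pos x) t \<Longrightarrow> M t = 0"
  obtains s t where "s \<in> gens" "t \<in> gens"
    "sep (pos x) (pos (t \<circ> (s \<circ> x))) = {w}"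
    "\<And>v. v \<in> V \<Longrightarrow> lp (t \<circ> (s \<circ> x)) v = (if v = pos x then M else lp x v)"
proof -
  obtain s where s: "s \<in> gens" and p: "pos (s \<circ> x) = pos x"
    and l: "\<And>v. v \<in> V \<Longrightarrow> lp (s \<circ> x) v = (if v = pos x then M else lp x v)"
    using adjust_lp[OF x M] by blast
  have sx: "s \<circ> x \<in> carrier (Aff q)" using Aff_comp[OF x DA_Aff[OF gens_DA[OF s]]] .
  have g: "shift_by 1 \<in> gens" "shift_by (- 1) \<in> gens" by (auto simp: gens_def)
  show ?thesis
  proof (cases "w = pos x")
    case True
    then show ?thesis
      using that[OF s g(1)] pos_comp_shift_up[OF sx] p lp_comp_shift[OF sx] l sep_ancestor[OF pos_in_V[OF x]]
      by simp
  next
    case False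
    then obtain t where t: "t < q" "w = child (pos x) t" using w by (auto simp: edges_at_def)
    then have "lp (s \<circ> x) (pos (s \<circ> x)) t = 0" using M0 l[OF pos_in_V[OF x]] p by simp
    from that[OF s g(2)] pos_comp_shift_down[OF sx t(1) this] p lp_comp_shift[OF sx] l t
      sep_child[OF pos_in_V[OF x] t(1)]
    show ?thesis by simp
  qed
qed

text \<open>For a child \<open>w\<close> of some vertex with \<open>pos y\<close> below
  \<open>w\<close>, the image of \<open>w\<close> under \<open>y\<close> is an ancestor of the root
  or the root itself. Its last digit 0 is the value of the local permutation of \<open>y\<close> at
  this child, so the final permutation already opens the way to \<open>pos y\<close>.\<close>

lemma below_orig_digit: "below orig u \<Longrightarrow> snd u (fst u) = 0"
proof -
  assume "below orig u"
  then obtain n where "u = omega_ray n" unfolding below_def omega_ray_eq[symmetric] by blast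
  then show ?thesis by (simp add: omega_ray_def)
qed

lemma sep_step:
  assumes "sep P P' = {w}" shows "u \<in> sep P' b \<longleftrightarrow> (u \<in> sep P b) \<noteq> (u = w)"
proof -
  have "u \<in> V \<Longrightarrow> below P u = below P' u \<longleftrightarrow> u \<noteq> w" and "w \<in> V" using assms by (auto simp: sep_def)
  then show ?thesis by (auto simp: sep_def)
qed

text \<open>This is an excursion: \<open>w\<close> does not lead to \<open>pos y\<close>, so after
  the crossing it separates the walker from \<open>pos y\<close> and stays in the set. The
  permutation left behind at \<open>pos x\<close> may be arbitrary, since before the crossing no
  edge separates \<open>pos x\<close> from itself, and \<open>w\<close> belongs to the set
  anyway.\<close>

lemma diff_edges_keep:
  assumes s: "sep (pos x) (pos x') = {w}"
    and lp: "\<And>v. v \<in> V \<Longrightarrow> v \<noteq> pos x \<Longrightarrow> lp x' v = lp x v"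
    and w: "w \<in> diff_edges x y" "w \<notin> sep (pos x) (pos y)"
  shows "diff_edges x' y = diff_edges x y"
proof -
  have d: "b \<noteq> pos x \<Longrightarrow> b \<in> diff_lp x' y \<longleftrightarrow> b \<in> diff_lp x y" for b using lp[of b] by (auto simp: diff_lp_def)
  have "u \<in> diff_edges x' y \<longleftrightarrow> u \<in> diff_edges x y" for u
  proof (cases "u = w")
    case True
    then show ?thesis using w sep_step[OF s, of w "pos y"] unfolding diff_edges_eq by blast
  next
    case False
    then have "u \<in> diff_edges x' y \<longleftrightarrow> (\<exists>b\<in>insert (pos y) (diff_lp x' y). u \<in> sep (pos x) b)"
      using sep_step[OF s, of u] unfolding diff_edges_eq by blast
    also have "\<dots> \<longleftrightarrow> u \<in> diff_edges x y"
      using d sep_self[of "pos x"] unfolding diff_edges_eq UN_iff bex_simps(5) by (metis empty_iff)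
    finally show ?thesis .
  qed
  then show ?thesis by blast
qed

text \<open>By \<open>none\<close>, the first edge towards any remaining goal leads to
  \<open>pos y\<close> as well and hence is \<open>w\<close>. After the crossing all goals are on
  the walker's side of \<open>w\<close>.\<close>

lemma diff_edges_drop:
  assumes x: "x \<in> carrier (Aff q)" and y: "y \<in> carrier (Aff q)"
    and s: "sep (pos x) (pos x') = {w}"
    and lp: "\<And>v. v \<in> V \<Longrightarrow> lp x' v = (if v = pos x then lp y v else lp x v)"
    and w: "w \<in> edges_at (pos x)" "w \<in> sep (pos x) (pos y)"
    and none: "edges_at (pos x) \<inter> diff_edges x y \<subseteq> sep (pos x) (pos y)"
  shows "diff_edges x' y = diff_edges x y - {w}"
proof -
  have d: "b \<in> diff_lp x' y \<longleftrightarrow> b \<in> diff_lp x y \<and> b \<noteq> pos x" for b using lp[of b] by (auto simp: diff_lp_def)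
  have "u \<in> diff_edges x' y \<longleftrightarrow> u \<in> diff_edges x y - {w}" for u
  proof (cases "u = w")
    case True
    have "w \<in> sep (pos x) b" if b: "b \<in> insert (pos y) (diff_lp x' y)" for b
    proof -
      have "b \<in> V" "b \<noteq> pos x" using b d pos_in_V[OF y] w by (auto simp: diff_lp_def)
      then obtain w' where w': "w' \<in> edges_at (pos x)" "w' \<in> sep (pos x) b"
        using edge_towards[OF pos_in_V[OF x]] by blast
      then have "w' \<in> diff_edges x y" using b d by (auto simp: diff_edges_eq)
      then have "w' \<in> sep (pos x) (pos y)" using none w' by blast
      then have "w' = w" using edge_towards_unique[OF pos_in_V[OF x]] w w' by blast
      then show ?thesis using w' by simp
    qed
    then show ?thesis using sep_step[OF s, of w] True unfolding diff_edges_eq by blast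
  next
    case False
    then have "u \<in> diff_edges x' y \<longleftrightarrow> (\<exists>b\<in>insert (pos y) (diff_lp x' y). u \<in> sep (pos x) b)"
      using sep_step[OF s, of u] unfolding diff_edges_eq by blast
    also have "\<dots> \<longleftrightarrow> u \<in> diff_edges x y"
      using d sep_self[of "pos x"] unfolding diff_edges_eq UN_iff bex_simps(5) by (metis empty_iff)
    finally show ?thesis using False by blast
  qed
  then show ?thesis by blast
qed

text \<open>A walker at \<open>pos x\<close> makes a depth-first traversal of the tree spanned by \<open>pos x\<close>, \<open>pos y\<close> and the
  vertices where the portraits differ, changing the local permutations to those of \<open>y\<close>
  when it leaves a vertex for the last time. An edge off the geodesic from \<open>pos x\<close> to \<open>pos y\<close> still
  has to be crossed twice.\<close>

lemma length_le_diff_edges: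
  fixes L :: "(vertex \<Rightarrow> vertex) \<Rightarrow> nat"
  assumes subadd: "\<And>a b. a \<in> carrier (DA q) \<Longrightarrow> b \<in> carrier (DA q) \<Longrightarrow> L (b \<circ> a) \<le> L a + L b"
    and K: "\<And>t. t \<in> gens \<Longrightarrow> L t \<le> K"
    and x: "x \<in> carrier (DA q)" and y: "y \<in> carrier (DA q)"
  shows "L (y \<circ> pinv x) \<le> K * (4 * card (diff_edges x y) + 1)"
proof -
  \<comment> \<open>The first crossing of an edge off the geodesic lowers the second summand, as the
    edge then lies on the geodesic; the last crossing lowers the first.\<close>
  define \<Psi> where "\<Psi> x = card (diff_edges x y) + card (diff_edges x y - sep (pos x) (pos y))" for x
  have step: "L (y \<circ> pinv x) \<le> K + L (y \<circ> pinv (t \<circ> x))"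
    if x: "x \<in> carrier (DA q)" and t: "t \<in> gens" for x t
  proof -
    have tx: "t \<circ> x \<in> carrier (DA q)" using DA_comp[OF x gens_DA[OF t]] .
    have "pinv (t \<circ> x) \<in> carrier (DA q)"
      using DA_m_inv[OF tx] group.inv_closed[OF group_DA tx] by simp
    then have c: "y \<circ> pinv (t \<circ> x) \<in> carrier (DA q)" using DA_comp y by blast
    have "pinv (t \<circ> x) \<circ> t = pinv x"
    proof
      fix v show "(pinv (t \<circ> x) \<circ> t) v = pinv x v"
        using Aff_inv_left[OF DA_Aff[OF tx], of "pinv x v"] Aff_inv_right[OF DA_Aff[OF x], of v] by simp
    qed
    then have "y \<circ> pinv x = (y \<circ> pinv (t \<circ> x)) \<circ> t" by (simp add: comp_assoc)
    then show ?thesis using subadd[OF gens_DA[OF t] c] K[OF t] by simp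
  qed
  \<comment> \<open>Each crossing costs a rotation and a shift; the final 1 is the rotation at the
    goal.\<close>
  have "L (y \<circ> pinv x) \<le> K * (2 * n + 1)" if "x \<in> carrier (DA q)" "\<Psi> x = n" for n x
    using that
  proof (induction n arbitrary: x rule: less_induct)
    case (less n)
    note xD = less.prems(1)
    then have xA: "x \<in> carrier (Aff q)" and yA: "y \<in> carrier (Aff q)" using y DA_Aff by auto
    let ?P = "pos x" and ?Q = "pos y"
    have PV: "?P \<in> V" and QV: "?Q \<in> V" using pos_in_V xA yA by auto
    have fin: "finite (diff_edges x y)" using finite_diff_edges[OF xD y] .
    have IH: "L (y \<circ> pinv x) \<le> K * (2 * n + 1)"
      if s: "s \<in> gens" and t: "t \<in> gens" and less': "\<Psi> (t \<circ> (s \<circ> x)) < n" for s t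
    proof -
      have sx: "s \<circ> x \<in> carrier (DA q)" using DA_comp[OF xD gens_DA[OF s]] .
      have tsx: "t \<circ> (s \<circ> x) \<in> carrier (DA q)" using DA_comp[OF sx gens_DA[OF t]] .
      have "L (y \<circ> pinv x) \<le> 2 * K + L (y \<circ> pinv (t \<circ> (s \<circ> x)))"
        using step[OF xD s] step[OF sx t] by simp
      also have "\<dots> \<le> 2 * K + K * (2 * \<Psi> (t \<circ> (s \<circ> x)) + 1)"
        using add_left_mono[OF less.IH[OF less' tsx refl], of "2 * K"] .
      also have "\<dots> = K * (2 * Suc (\<Psi> (t \<circ> (s \<circ> x))) + 1)" by (simp add: algebra_simps)
      also have "\<dots> \<le> K * (2 * n + 1)" using less' by (intro mult_left_mono) auto
      finally show ?thesis .
    qed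
    show ?case
    proof (cases "edges_at ?P \<inter> diff_edges x y \<subseteq> sep ?P ?Q")
      case False
      then obtain w where w: "w \<in> edges_at ?P" "w \<in> diff_edges x y" "w \<notin> sep ?P ?Q" by blast
      obtain M where M: "M permutes {..<q}" and M0: "\<And>t. t < q \<Longrightarrow> w = child ?P t \<Longrightarrow> M t = 0"
      proof (cases "\<exists>t<q. w = child ?P t")
        case True
        then obtain t where t: "t < q" "w = child ?P t" by blast
        have "Transposition.transpose t 0 permutes {..<q}" using t by (intro permutes_swap_id) auto
        then show ?thesis using that[of "Transposition.transpose t 0"] t PV by auto
      next
        case False
        then show ?thesis using that[OF permutes_id] by blast
      qed
      obtain s t where st: "s \<in> gens" "t \<in> gens" and sp: "sep ?P (pos (t \<circ> (s \<circ> x))) = {w}"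
        and lp: "\<And>v. v \<in> V \<Longrightarrow> lp (t \<circ> (s \<circ> x)) v = (if v = ?P then M else lp x v)"
        using cross_edge[OF xA w(1) M M0] by blast
      have E: "diff_edges (t \<circ> (s \<circ> x)) y = diff_edges x y"
        using diff_edges_keep[OF sp _ w(2,3)] lp by simp
      have "diff_edges x y - sep (pos (t \<circ> (s \<circ> x))) ?Q = (diff_edges x y - sep ?P ?Q) - {w}"
        using sep_step[OF sp, of _ ?Q] w by blast
      moreover have "w \<in> diff_edges x y - sep ?P ?Q" using w by blast
      ultimately have "card (diff_edges x y - sep (pos (t \<circ> (s \<circ> x))) ?Q) < card (diff_edges x y - sep ?P ?Q)"
        using fin by (metis card_Diff1_less finite_Diff)
      then have "\<Psi> (t \<circ> (s \<circ> x)) < n" using E less.prems(2) by (simp add: \<Psi>_def)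
      then show ?thesis using IH st by blast
    next
      case none: True
      show ?thesis
      proof (cases "?Q = ?P")
        case False
        then obtain w where w: "w \<in> edges_at ?P" "w \<in> sep ?P ?Q" using edge_towards[OF PV QV] by blast
        \<comment> \<open>Everything left to do lies across \<open>w\<close>, so \<open>?P\<close>
          receives its final permutation now.\<close>
        have M: "lp y ?P permutes {..<q}" using lp_permutes[OF yA PV] .
        have M0: "lp y ?P t = 0" if t: "t < q" "w = child ?P t" for t
        proof -
          have "\<not> below ?P w" using below_level t by fastforce
          then have "below ?Q w" using w by (auto simp: sep_def)
          then have "below orig (y w)" using Aff_below[OF yA QV] apply_pos[OF yA] by metis
          moreover have "y w = child (y ?P) (lp y ?P t)" using Aff_child[OF yA PV] t by simp
          ultimately show ?thesis using below_orig_digit by fastforce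
        qed
        obtain s t where st: "s \<in> gens" "t \<in> gens" and sp: "sep ?P (pos (t \<circ> (s \<circ> x))) = {w}"
          and lp: "\<And>v. v \<in> V \<Longrightarrow> lp (t \<circ> (s \<circ> x)) v = (if v = ?P then lp y ?P else lp x v)"
          using cross_edge[OF xA w(1) M M0] by blast
        have E: "diff_edges (t \<circ> (s \<circ> x)) y = diff_edges x y - {w}"
          using diff_edges_drop[OF xA yA sp _ w none] lp by simp
        have "diff_edges x y - {w} - sep (pos (t \<circ> (s \<circ> x))) ?Q = diff_edges x y - sep ?P ?Q"
          using sep_step[OF sp, of _ ?Q] w by blast
        moreover have "w \<in> diff_edges x y" using w unfolding diff_edges_eq by blast
        then have "card (diff_edges x y - {w}) < card (diff_edges x y)"
          by (rule card_Diff1_less[OF fin])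
        ultimately have "\<Psi> (t \<circ> (s \<circ> x)) < n" using less.prems(2) unfolding \<Psi>_def E by simp
        then show ?thesis using IH st by blast
      next
        case QP: True
        \<comment> \<open>No edge is left, so the portraits can differ only at the position itself,
          and one rotation ends the walk.\<close>
        have sub: "b = ?P" if "b \<in> diff_lp x y" for b
        proof (rule ccontr)
          assume "b \<noteq> ?P"
          moreover have "b \<in> V" using that by (simp add: diff_lp_def)
          ultimately obtain w where w: "w \<in> edges_at ?P" "w \<in> sep ?P b"
            using edge_towards[OF PV] by blast
          then have "w \<in> diff_edges x y" using that unfolding diff_edges_eq by blast
          then show False using none w QP by auto
        qed
        obtain t where t: "t \<in> gens" "pos (t \<circ> x) = ?P"
          and lp: "\<And>v. v \<in> V \<Longrightarrow> lp (t \<circ> x) v = (if v = ?P then lp y ?P else lp x v)"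
          by (rule adjust_lp[OF xA lp_permutes[OF yA PV]]) (rule that)
        have "lp (t \<circ> x) v = lp y v" if "v \<in> V" for v
        proof (cases "v = ?P")
          case True
          show ?thesis unfolding lp[OF that] if_P[OF True] unfolding True ..
        next
          case False
          then have "v \<notin> diff_lp x y" using sub by blast
          then show ?thesis using that False by (simp only: lp[OF that] if_False diff_lp_def mem_Collect_eq simp_thms)
        qed
        moreover have "pos (t \<circ> x) = pos y" using t QP by simp
        ultimately have "t \<circ> x = y"
          using Aff_eqI[OF Aff_comp[OF xA DA_Aff[OF gens_DA[OF t(1)]]] yA] by blast
        then have "y \<circ> pinv x = t" using Aff_inv_right[OF xA] unfolding fun_eq_iff comp_apply by metis
        then show ?thesis using K[OF t(1)] by simp
      qed
    qed
  qed
  then have "L (y \<circ> pinv x) \<le> K * (2 * \<Psi> x + 1)" using x by blast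
  also have "\<dots> \<le> K * (4 * card (diff_edges x y) + 1)"
    using card_mono[OF finite_diff_edges[OF x y], of "diff_edges x y - sep (pos x) (pos y)"]
    by (intro mult_left_mono) (auto simp: \<Psi>_def)
  finally show ?thesis .
qed

end

section \<open>An inequality for real functions on the discrete cube\<close>

lemma powr_mean_le:
  fixes a b p :: real
  assumes "1 \<le> p" "0 \<le> a" "0 \<le> b"
  shows "((a + b) / 2) powr p \<le> (a powr p + b powr p) / 2"
proof -
  have half: "(c / 2) powr p \<le> c powr p / 2" if "0 \<le> c" for c :: real
  proof -
    have "(1 / 2 :: real) powr p \<le> (1 / 2) powr 1" using assms by (intro powr_mono') auto
    then have "c powr p * (1 / 2) powr p \<le> c powr p * (1 / 2)" by (intro mult_left_mono) auto
    then show ?thesis using that powr_mult[of c "1 / 2" p] by simp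
  qed
  consider "a = 0" | "b = 0" | "0 < a" "0 < b" using assms by linarith
  then show ?thesis
  proof cases
    case 3
    then show ?thesis using convex_onD[OF powr_convex[OF assms(1)], of "1/2" a b]
      by (simp add: field_simps)
  qed (use half[of a] half[of b] assms in auto)
qed

lemma abs_mean_powr_le:
  fixes u v p :: real
  assumes "1 \<le> p"
  shows "\<bar>(u + v) / 2\<bar> powr p \<le> (\<bar>u\<bar> powr p + \<bar>v\<bar> powr p) / 2"
proof -
  have "\<bar>(u + v) / 2\<bar> powr p \<le> ((\<bar>u\<bar> + \<bar>v\<bar>) / 2) powr p"
    using assms by (intro powr_mono2) auto
  then show ?thesis using powr_mean_le[OF assms, of "\<bar>u\<bar>" "\<bar>v\<bar>"] by simp
qed

lemma powr_add_le:
  fixes a b r :: real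
  assumes "0 \<le> r" "r \<le> 1" "0 \<le> a" "0 \<le> b"
  shows "(a + b) powr r \<le> a powr r + b powr r"
proof (cases "a + b = 0")
  case False
  have *: "c / (a + b) * (a + b) powr r \<le> c powr r" if "0 \<le> c" "c \<le> a + b" for c
  proof (cases "c = 0")
    case c: False
    have "c / (a + b) = (c / (a + b)) powr 1" using that c by simp
    also have "\<dots> \<le> (c / (a + b)) powr r"
      using that c assms by (intro powr_mono') auto
    finally have "c / (a + b) * (a + b) powr r \<le> (c / (a + b)) powr r * (a + b) powr r"
      by (intro mult_right_mono) auto
    also have "\<dots> = c powr r" using that c assms by (simp add: powr_divide)
    finally show ?thesis .
  qed simp
  have "(a + b) powr r = a / (a + b) * (a + b) powr r + b / (a + b) * (a + b) powr r"
    using False by (simp flip: distrib_right add_divide_distrib)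
  also have "\<dots> \<le> a powr r + b powr r" using *[of a] *[of b] assms by simp
  finally show ?thesis .
qed (use assms in simp)

text \<open>The mean of order p is at most the quadratic mean, which the parallelogram law
  evaluates; then s^(p/2) is subadditive because p/2 <= 1.\<close>

lemma two_point_small:
  fixes p x y :: real
  assumes p: "1 \<le> p" "p \<le> 2"
  shows "(\<bar>x + y\<bar> powr p + \<bar>x - y\<bar> powr p) / 2 \<le> \<bar>x\<bar> powr p + \<bar>y\<bar> powr p"
proof -
  define M where "M = (\<bar>x + y\<bar> powr p + \<bar>x - y\<bar> powr p) / 2"
  have sq: "(\<bar>z\<bar> powr p) powr (2 / p) = z\<^sup>2" for z :: real
    using p by (cases "z = 0") (simp_all add: powr_powr)
  have "M powr (2 / p) \<le> ((\<bar>x + y\<bar> powr p) powr (2 / p) + (\<bar>x - y\<bar> powr p) powr (2 / p)) / 2"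
    unfolding M_def using p by (intro powr_mean_le) auto
  also have "\<dots> = x\<^sup>2 + y\<^sup>2" by (simp add: sq power2_eq_square algebra_simps)
  finally have "(M powr (2 / p)) powr (p / 2) \<le> (x\<^sup>2 + y\<^sup>2) powr (p / 2)"
    using p by (intro powr_mono2) auto
  moreover have "(M powr (2 / p)) powr (p / 2) = M" using p by (simp add: powr_powr M_def)
  moreover have "(x\<^sup>2 + y\<^sup>2) powr (p / 2) \<le> (x\<^sup>2) powr (p / 2) + (y\<^sup>2) powr (p / 2)"
    using p by (intro powr_add_le) auto
  moreover have "(z\<^sup>2) powr (p / 2) = \<bar>z\<bar> powr p" for z :: real
  proof -
    have "z\<^sup>2 = \<bar>z\<bar> powr 2" by (cases "z = 0") simp_all
    then show ?thesis by (simp only: powr_powr) simp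
  qed
  ultimately show ?thesis by (simp add: M_def)
qed

lemma exp_sum_le:
  fixes z :: real
  assumes "0 \<le> z" "z \<le> 1"
  shows "(exp z + exp (- z)) / 2 \<le> 1 + z\<^sup>2"
proof -
  have "exp (- z) \<le> 1 / (1 + z)"
    using exp_ge_add_one_self[of z] assms by (simp add: exp_minus inverse_eq_divide frac_le)
  also have "\<dots> \<le> 1 - z + z\<^sup>2"
  proof -
    have "(1 - z + z\<^sup>2) * (1 + z) = 1 + z ^ 3"
      by (simp add: algebra_simps power2_eq_square power3_eq_cube)
    then have "1 \<le> (1 - z + z\<^sup>2) * (1 + z)" using assms by simp
    then show ?thesis using assms by (simp add: divide_le_eq)
  qed
  finally show ?thesis using exp_bound[OF assms] by simp
qed

text \<open>For t = |y|/|x| small the left side is at most |x|^p (1 + p^2 t^2), and the quadratic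
  term has to be shared between |x|^p and |y|^p. A share 1/N of |x|^p is affordable, since it will
  be paid N times in an induction over N coordinates. The summand (p + 1)^p of \<open>C\<close>
  serves the case of large t.\<close>

lemma two_point_large:
  fixes p x y N :: real
  assumes p: "2 \<le> p" and N: "1 \<le> N"
  defines "C \<equiv> (p + 1) powr p + p\<^sup>2"
  shows "(\<bar>x + y\<bar> powr p + \<bar>x - y\<bar> powr p) / 2
    \<le> (1 + C / N) * \<bar>x\<bar> powr p + C * N powr (p / 2 - 1) * \<bar>y\<bar> powr p"
proof -
  have C0: "0 \<le> C" by (simp add: C_def)
  have Ns: "1 \<le> N powr (p / 2 - 1)" using N p by (simp add: ge_one_powr_ge_zero)
  show ?thesis
  \<comment> \<open>The threshold gives \<open>p * t \<le> 1\<close> in the second case, as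
    \<open>exp_sum_le\<close> requires.\<close>
  proof (cases "\<bar>x\<bar> \<le> p * \<bar>y\<bar>")
    case True
    have "\<bar>x + y\<bar> powr p \<le> ((p + 1) * \<bar>y\<bar>) powr p" "\<bar>x - y\<bar> powr p \<le> ((p + 1) * \<bar>y\<bar>) powr p"
      using True p by (intro powr_mono2; simp add: algebra_simps)+
    then have "(\<bar>x + y\<bar> powr p + \<bar>x - y\<bar> powr p) / 2 \<le> (p + 1) powr p * \<bar>y\<bar> powr p"
      using p by (simp add: powr_mult)
    also have "\<dots> \<le> C * N powr (p / 2 - 1) * \<bar>y\<bar> powr p"
    proof (rule mult_right_mono)
      have "(p + 1) powr p * 1 \<le> C * N powr (p / 2 - 1)"
        using Ns by (intro mult_mono) (auto simp: C_def)
      then show "(p + 1) powr p \<le> C * N powr (p / 2 - 1)" by simp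
    qed simp
    also have "\<dots> \<le> (1 + C / N) * \<bar>x\<bar> powr p + C * N powr (p / 2 - 1) * \<bar>y\<bar> powr p"
      using C0 N by simp
    finally show ?thesis .
  next
    case False
    define t where "t = \<bar>y\<bar> / \<bar>x\<bar>"
    have x0: "0 < \<bar>x\<bar>" using False p by (cases "x = 0") auto
    have t: "0 \<le> t" "p * t \<le> 1" using False x0 by (auto simp: t_def field_simps)
    have "t \<le> p * t" using t p by (intro mult_le_cancel_right1[THEN iffD2]) auto
    then have t1: "t \<le> 1" using t by simp
    have y: "\<bar>y\<bar> = \<bar>x\<bar> * t" using x0 by (simp add: t_def)
    have e: "(1 + t) powr p \<le> exp (p * t)" "(1 - t) powr p \<le> exp (- (p * t))"
    proof -
      have "(1 + t) powr p \<le> exp t powr p" using t p exp_ge_add_one_self[of t] by (intro powr_mono2) auto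
      then show "(1 + t) powr p \<le> exp (p * t)" by (simp add: powr_def)
      have "(1 - t) powr p \<le> exp (- t) powr p" using t1 p exp_ge_add_one_self[of "- t"] by (intro powr_mono2) auto
      then show "(1 - t) powr p \<le> exp (- (p * t))" by (simp add: powr_def)
    qed
    \<comment> \<open>Either t^2 <= 1/N, or t^2 N > 1 and multiplication by (t^2 N)^(p/2-1) >= 1
      turns t^2 into the second term.\<close>
    have t2: "t\<^sup>2 \<le> 1 / N + N powr (p / 2 - 1) * t powr p"
    proof (cases "t\<^sup>2 * N \<le> 1")
      case True
      then have "t\<^sup>2 \<le> 1 / N" using N by (simp add: field_simps)
      then show ?thesis by (simp add: add_increasing2)
    next
      case False
      then have "t \<noteq> 0" by auto
      then have t0: "0 < t" using t by simp
      have "1 \<le> (t\<^sup>2 * N) powr (p / 2 - 1)" using False p by (intro ge_one_powr_ge_zero) auto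
      then have "t\<^sup>2 * 1 \<le> t\<^sup>2 * (t\<^sup>2 * N) powr (p / 2 - 1)" by (intro mult_left_mono) auto
      also have "\<dots> = N powr (p / 2 - 1) * (t powr 2 * (t powr 2) powr (p / 2 - 1))"
        using t0 N by (simp add: powr_mult)
      also have "t powr 2 * (t powr 2) powr (p / 2 - 1) = t powr p"
        by (simp add: powr_powr flip: powr_add)
      finally have "t\<^sup>2 \<le> N powr (p / 2 - 1) * t powr p" by simp
      then show ?thesis using N by (simp add: add_increasing)
    qed
    have "\<bar>x + y\<bar> powr p + \<bar>x - y\<bar> powr p = (\<bar>x\<bar> + \<bar>y\<bar>) powr p + (\<bar>x\<bar> - \<bar>y\<bar>) powr p"
    proof -
      have "\<bar>y\<bar> \<le> \<bar>x\<bar>" using y t1 x0 by (simp add: mult_left_le)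
      then have "\<bar>x + y\<bar> = \<bar>x\<bar> + \<bar>y\<bar> \<and> \<bar>x - y\<bar> = \<bar>x\<bar> - \<bar>y\<bar> \<or> \<bar>x + y\<bar> = \<bar>x\<bar> - \<bar>y\<bar> \<and> \<bar>x - y\<bar> = \<bar>x\<bar> + \<bar>y\<bar>"
        by linarith
      then show ?thesis by auto
    qed
    also have "\<dots> = \<bar>x\<bar> powr p * ((1 + t) powr p + (1 - t) powr p)"
    proof -
      have "\<bar>x\<bar> + \<bar>y\<bar> = \<bar>x\<bar> * (1 + t)" "\<bar>x\<bar> - \<bar>y\<bar> = \<bar>x\<bar> * (1 - t)" by (simp_all add: y algebra_simps)
      moreover have "(\<bar>x\<bar> * (1 + t)) powr p = \<bar>x\<bar> powr p * (1 + t) powr p"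
        "(\<bar>x\<bar> * (1 - t)) powr p = \<bar>x\<bar> powr p * (1 - t) powr p"
        using t t1 by (simp_all add: powr_mult)
      ultimately show ?thesis by (simp only: distrib_left)
    qed
    finally have "(\<bar>x + y\<bar> powr p + \<bar>x - y\<bar> powr p) / 2 = \<bar>x\<bar> powr p * (((1 + t) powr p + (1 - t) powr p) / 2)"
      by simp
    also have "\<dots> \<le> \<bar>x\<bar> powr p * (1 + (p * t)\<^sup>2)"
      using e exp_sum_le[of "p * t"] t p by (intro mult_left_mono) auto
    also have "\<dots> \<le> \<bar>x\<bar> powr p * (1 + C * (1 / N + N powr (p / 2 - 1) * t powr p))"
    proof -
      have "(p * t)\<^sup>2 \<le> C * (1 / N + N powr (p / 2 - 1) * t powr p)"
        unfolding power_mult_distrib using t2 by (intro mult_mono) (auto simp: C_def)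
      then show ?thesis by (intro mult_left_mono) auto
    qed
    also have "\<dots> = (1 + C / N) * \<bar>x\<bar> powr p + C * N powr (p / 2 - 1) * \<bar>y\<bar> powr p"
      using t by (simp add: y powr_mult algebra_simps)
    finally show ?thesis .
  qed
qed

lemma two_point:
  fixes p :: real
  assumes p: "1 \<le> p"
  obtains C where "0 \<le> C"
    "\<And>N x y :: real. 1 \<le> N \<Longrightarrow> (\<bar>x + y\<bar> powr p + \<bar>x - y\<bar> powr p) / 2
       \<le> (1 + C / N) * \<bar>x\<bar> powr p + C * N powr max (p / 2 - 1) 0 * \<bar>y\<bar> powr p"
proof (cases "p \<le> 2")
  case True
  show ?thesis
  proof (rule that[of 1])
    fix N x y :: real assume N: "1 \<le> N"
    have "1 * \<bar>x\<bar> powr p \<le> (1 + 1 / N) * \<bar>x\<bar> powr p"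
      using N by (intro mult_right_mono) auto
    then have "\<bar>x\<bar> powr p + \<bar>y\<bar> powr p \<le> (1 + 1 / N) * \<bar>x\<bar> powr p + \<bar>y\<bar> powr p" by simp
    with two_point_small[OF p True, of x y]
    have "(\<bar>x + y\<bar> powr p + \<bar>x - y\<bar> powr p) / 2 \<le> (1 + 1 / N) * \<bar>x\<bar> powr p + \<bar>y\<bar> powr p"
      by (rule order_trans)
    moreover have "max (p / 2 - 1) 0 = 0" using True by simp
    ultimately show "(\<bar>x + y\<bar> powr p + \<bar>x - y\<bar> powr p) / 2
       \<le> (1 + 1 / N) * \<bar>x\<bar> powr p + 1 * N powr max (p / 2 - 1) 0 * \<bar>y\<bar> powr p"
      using N by simp
  qed simp
next
  case False
  then have s: "max (p / 2 - 1) 0 = p / 2 - 1" by simp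
  show ?thesis
    by (rule that[of "(p + 1) powr p + p\<^sup>2"]) (use two_point_large False in \<open>auto simp: s\<close>)
qed

section \<open>The cube inequality, by induction on the dimension\<close>

lemma sum_Pow_insert:
  fixes g :: "'a set \<Rightarrow> real"
  assumes "finite I" "j \<notin> I"
  shows "(\<Sum>A\<in>Pow (insert j I). g A) = (\<Sum>A\<in>Pow I. g A + g (insert j A))"
proof -
  have "(\<Sum>A\<in>Pow (insert j I). g A) = (\<Sum>A\<in>Pow I. g A) + (\<Sum>A\<in>insert j ` Pow I. g A)"
    unfolding Pow_insert using assms by (intro sum.union_disjoint) auto
  also have "(\<Sum>A\<in>insert j ` Pow I. g A) = (\<Sum>A\<in>Pow I. g (insert j A))"
    using assms by (subst sum.reindex) (auto intro!: inj_onI dest: insert_ident[THEN iffD1, rotated 2])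
  finally show ?thesis by (simp add: sum.distrib)
qed

lemma sum_Pow_complement:
  fixes g :: "'a set \<Rightarrow> real"
  shows "(\<Sum>A\<in>Pow I. g (I - A)) = (\<Sum>A\<in>Pow I. g A)"
  by (rule sum.reindex_bij_witness[of _ "\<lambda>A. I - A" "\<lambda>A. I - A"]) auto

definition cube_diag :: "real \<Rightarrow> 'a set \<Rightarrow> ('a set \<Rightarrow> real) \<Rightarrow> real" where
  "cube_diag p I f = (\<Sum>A\<in>Pow I. \<bar>f A - f (I - A)\<bar> powr p)"

text \<open>The two end points of an edge give the same term, so each edge is counted twice; so is
  each diagonal in \<open>cube_diag\<close>.\<close>

definition cube_edge :: "real \<Rightarrow> 'a set \<Rightarrow> ('a set \<Rightarrow> real) \<Rightarrow> real" where
  "cube_edge p I f = (\<Sum>A\<in>Pow I. \<Sum>i\<in>I. \<bar>f (insert i A) - f (A - {i})\<bar> powr p)"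

lemma cube_edge_insert:
  assumes "finite I" "j \<notin> I"
  shows "cube_edge p (insert j I) f = cube_edge p I f + cube_edge p I (\<lambda>A. f (insert j A))
    + 2 * (\<Sum>A\<in>Pow I. \<bar>f (insert j A) - f A\<bar> powr p)"
proof -
  have "cube_edge p (insert j I) f = (\<Sum>A\<in>Pow I.
      (\<Sum>i\<in>insert j I. \<bar>f (insert i A) - f (A - {i})\<bar> powr p)
    + (\<Sum>i\<in>insert j I. \<bar>f (insert i (insert j A)) - f (insert j A - {i})\<bar> powr p))"
    unfolding cube_edge_def using assms by (rule sum_Pow_insert)
  also have "\<dots> = (\<Sum>A\<in>Pow I. 2 * \<bar>f (insert j A) - f A\<bar> powr p
      + (\<Sum>i\<in>I. \<bar>f (insert i A) - f (A - {i})\<bar> powr p)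
      + (\<Sum>i\<in>I. \<bar>f (insert j (insert i A)) - f (insert j (A - {i}))\<bar> powr p))"
  proof (rule sum.cong[OF refl])
    fix A assume A: "A \<in> Pow I"
    then have j: "j \<notin> A" "A - {j} = A" "insert j A - {j} = A" using assms by auto
    have "insert i (insert j A) = insert j (insert i A)" "insert j A - {i} = insert j (A - {i})" if "i \<in> I" for i
      using that assms by auto
    then have "(\<Sum>i\<in>I. \<bar>f (insert i (insert j A)) - f (insert j A - {i})\<bar> powr p)
      = (\<Sum>i\<in>I. \<bar>f (insert j (insert i A)) - f (insert j (A - {i}))\<bar> powr p)"
      by (intro sum.cong) auto
    then show "(\<Sum>i\<in>insert j I. \<bar>f (insert i A) - f (A - {i})\<bar> powr p)
      + (\<Sum>i\<in>insert j I. \<bar>f (insert i (insert j A)) - f (insert j A - {i})\<bar> powr p)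
      = 2 * \<bar>f (insert j A) - f A\<bar> powr p
      + (\<Sum>i\<in>I. \<bar>f (insert i A) - f (A - {i})\<bar> powr p)
      + (\<Sum>i\<in>I. \<bar>f (insert j (insert i A)) - f (insert j (A - {i}))\<bar> powr p)"
      using assms j by simp
  qed
  also have "\<dots> = cube_edge p I f + cube_edge p I (\<lambda>A. f (insert j A))
    + 2 * (\<Sum>A\<in>Pow I. \<bar>f (insert j A) - f A\<bar> powr p)"
    by (simp add: cube_edge_def sum.distrib sum_distrib_left)
  finally show ?thesis .
qed

text \<open>The direction \<open>j\<close> splits the cube into two facets. A diagonal of each facet
  and two edges in direction \<open>j\<close> form a quadrilateral whose diagonals are diagonals of
  the whole cube. The two-point inequality bounds these by the averages of opposite sides, at the
  price of one factor \<open>a\<close> per dimension.\<close>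

lemma cube_ineq_induct:
  fixes p a b :: real
  assumes p: "1 \<le> p" and a: "1 \<le> a" and b: "0 \<le> b"
    and two: "\<And>x y :: real. (\<bar>x + y\<bar> powr p + \<bar>x - y\<bar> powr p) / 2 \<le> a * \<bar>x\<bar> powr p + b * \<bar>y\<bar> powr p"
    and "finite I"
  shows "cube_diag p I f \<le> a ^ card I * b * cube_edge p I f"
  using \<open>finite I\<close>
proof (induction I arbitrary: f rule: finite_induct)
  case empty
  then show ?case by (simp add: cube_diag_def cube_edge_def)
next
  case (insert j I)
  let ?g = "\<lambda>A. f (insert j A)"
  let ?u = "\<lambda>A. \<bar>f A - f (I - A)\<bar> powr p" and ?v = "\<lambda>A. \<bar>?g A - ?g (I - A)\<bar> powr p"
    and ?e = "\<lambda>A. \<bar>?g A - f A\<bar> powr p"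
  define S where "S = (\<Sum>A\<in>Pow I. ?e A)"
  have S0: "0 \<le> S" by (auto simp: S_def intro: sum_nonneg)
  have "cube_diag p (insert j I) f
      = (\<Sum>A\<in>Pow I. \<bar>f A - f (insert j I - A)\<bar> powr p + \<bar>?g A - f (insert j I - insert j A)\<bar> powr p)"
    unfolding cube_diag_def using insert.hyps by (intro sum_Pow_insert)
  also have "\<dots> = (\<Sum>A\<in>Pow I. \<bar>f A - ?g (I - A)\<bar> powr p + \<bar>?g A - f (I - A)\<bar> powr p)"
  proof (rule sum.cong[OF refl])
    fix A assume "A \<in> Pow I"
    then have "insert j I - A = insert j (I - A)" "insert j I - insert j A = I - A" using insert.hyps by auto
    then show "\<bar>f A - f (insert j I - A)\<bar> powr p + \<bar>?g A - f (insert j I - insert j A)\<bar> powr p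
      = \<bar>f A - ?g (I - A)\<bar> powr p + \<bar>?g A - f (I - A)\<bar> powr p" by simp
  qed
  also have "\<dots> \<le> (\<Sum>A\<in>Pow I. a * (?u A + ?v A) + b * (?e A + ?e (I - A)))"
  proof (rule sum_mono)
    fix A
    \<comment> \<open>the two long diagonals of the quadrilateral \<open>f A\<close>, \<open>f (I - A)\<close>, \<open>g (I - A)\<close>, \<open>g A\<close> are \<open>x \<plusminus> y\<close>\<close>
    define x where "x = ((f A - f (I - A)) + (?g A - ?g (I - A))) / 2"
    define y where "y = ((?g A - f A) + (?g (I - A) - f (I - A))) / 2"
    have xy: "x + y = ?g A - f (I - A)" "x - y = f A - ?g (I - A)" by (simp_all add: x_def y_def field_simps)
    have "\<bar>f A - ?g (I - A)\<bar> powr p + \<bar>?g A - f (I - A)\<bar> powr p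
        \<le> a * (2 * \<bar>x\<bar> powr p) + b * (2 * \<bar>y\<bar> powr p)"
      using two[of x y] unfolding xy by (simp add: field_simps)
    also have "\<dots> \<le> a * (?u A + ?v A) + b * (?e A + ?e (I - A))"
      using a b abs_mean_powr_le[OF p, of "f A - f (I - A)" "?g A - ?g (I - A)"]
        abs_mean_powr_le[OF p, of "?g A - f A" "?g (I - A) - f (I - A)"]
      by (intro add_mono mult_left_mono) (auto simp: x_def y_def)
    finally show "\<bar>f A - ?g (I - A)\<bar> powr p + \<bar>?g A - f (I - A)\<bar> powr p
        \<le> a * (?u A + ?v A) + b * (?e A + ?e (I - A))" .
  qed
  also have "\<dots> = a * (cube_diag p I f + cube_diag p I ?g) + b * (2 * S)"
  proof -
    have "(\<Sum>A\<in>Pow I. ?e (I - A)) = S" unfolding S_def by (rule sum_Pow_complement)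
    then show ?thesis by (simp add: S_def cube_diag_def sum.distrib flip: sum_distrib_left)
  qed
  also have "\<dots> \<le> a * (a ^ card I * b * cube_edge p I f + a ^ card I * b * cube_edge p I ?g)
      + a ^ Suc (card I) * b * (2 * S)"
  proof (rule add_mono)
    show "a * (cube_diag p I f + cube_diag p I ?g)
        \<le> a * (a ^ card I * b * cube_edge p I f + a ^ card I * b * cube_edge p I ?g)"
      using insert.IH[of f] insert.IH[of ?g] a by (intro mult_left_mono add_mono) auto
    have "1 * b \<le> a ^ Suc (card I) * b" using one_le_power[OF a] b by (rule mult_right_mono)
    from mult_right_mono[OF this, of "2 * S"] S0 show "b * (2 * S) \<le> a ^ Suc (card I) * b * (2 * S)" by simp
  qed
  also have "\<dots> = a ^ card (insert j I) * b * cube_edge p (insert j I) f"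
    unfolding cube_edge_insert[OF insert.hyps] card_insert_disjoint[OF insert.hyps]
    by (simp only: S_def power_Suc distrib_left distrib_right ac_simps)
  finally show ?case .
qed

text \<open>With N the dimension, the accumulated factor (1 + C/N)^N stays below
  \<open>exp C\<close>.\<close>

lemma cube_ineq:
  fixes p :: real
  assumes p: "1 \<le> p"
  obtains K where "0 \<le> K"
    "\<And>(I :: 'a set) f. finite I \<Longrightarrow> I \<noteq> {} \<Longrightarrow>
       cube_diag p I f \<le> K * real (card I) powr max (p / 2 - 1) 0 * cube_edge p I f"
proof -
  obtain C where C: "0 \<le> C"
    "\<And>N x y :: real. 1 \<le> N \<Longrightarrow> (\<bar>x + y\<bar> powr p + \<bar>x - y\<bar> powr p) / 2
       \<le> (1 + C / N) * \<bar>x\<bar> powr p + C * N powr max (p / 2 - 1) 0 * \<bar>y\<bar> powr p"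
    using two_point[OF p] by blast
  show ?thesis
  proof (rule that[of "exp C * C"])
    fix I :: "'a set" and f assume I: "finite I" "I \<noteq> {}"
    define N where "N = real (card I)"
    have "0 < card I" using I by (simp add: card_gt_0_iff)
    then have N: "1 \<le> N" by (simp add: N_def)
    have e0: "0 \<le> cube_edge p I f" by (auto simp: cube_edge_def intro!: sum_nonneg)
    have "cube_diag p I f \<le> (1 + C / N) ^ card I * (C * N powr max (p / 2 - 1) 0) * cube_edge p I f"
      using p C N I by (intro cube_ineq_induct) auto
    also have "\<dots> \<le> exp C * (C * N powr max (p / 2 - 1) 0) * cube_edge p I f"
    proof (intro mult_right_mono e0)
      have "(1 + C / N) ^ card I \<le> exp (C / N) ^ card I"
        using C N exp_ge_add_one_self[of "C / N"] by (intro power_mono) auto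
      also have "\<dots> = exp C" using N by (simp add: N_def flip: exp_of_nat_mult)
      finally show "(1 + C / N) ^ card I \<le> exp C" .
    qed (use C in auto)
    finally show "cube_diag p I f \<le> exp C * C * real (card I) powr max (p / 2 - 1) 0 * cube_edge p I f"
      by (simp add: N_def mult.assoc)
  qed (use C in auto)
qed

section \<open>Unconditional systems in $L_p$\<close>

lemma integral_const_unit: "integrable (lebesgue_on {0..1::real}) (\<lambda>_. c::real)"
    "(LINT x|lebesgue_on {0..1::real}. c::real) = c"
  by (simp_all add: measure_restrict_space integrable_const_ivl space_restrict_space)

lemma LINT_indicator_unit:
  assumes "0 \<le> a" "a \<le> b" "b \<le> (1::real)"
  shows "integrable (lebesgue_on {0..1}) (indicator {a<..b} :: real \<Rightarrow> real)"
    "(LINT x|lebesgue_on {0..1}. indicator {a<..b} x :: real) = b - a"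
proof -
  have sub: "{a<..b} \<inter> {0..1} = {a<..b}" "{a<..b} \<subseteq> {0..1}" using assms by auto
  have s: "{a<..b} \<in> sets (lebesgue_on {0..1})"
    using sub by (auto simp: sets_restrict_space image_iff intro!: bexI[of _ "{a<..b}"])
  have e: "emeasure (lebesgue_on {0..1}) {a<..b} = ennreal (b - a)"
    using assms sub by (subst emeasure_restrict_space) auto
  then show "integrable (lebesgue_on {0..1}) (indicator {a<..b} :: real \<Rightarrow> real)"
    using s by (intro integrable_real_indicator) auto
  show "(LINT x|lebesgue_on {0..1}. indicator {a<..b} x :: real) = b - a"
    using e assms sub by (simp add: measure_def space_restrict_space)
qed

section \<open>Disjointly supported functions, for exponents up to 2\<close>

definition dyadic :: "nat \<Rightarrow> real set" where
  "dyadic k = {1 / 2 ^ Suc k <.. 1 / 2 ^ k}"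

lemma dyadic_disjoint: "x \<in> dyadic j \<Longrightarrow> x \<in> dyadic k \<Longrightarrow> j = k"
proof (induction j k rule: linorder_wlog)
  case (le j k)
  show ?case
  proof (rule ccontr)
    assume "j \<noteq> k"
    then have "(1 / 2 ^ k :: real) \<le> 1 / 2 ^ Suc j"
      using le(1) by (intro divide_left_mono power_increasing) auto
    then show False using le(2,3) by (auto simp: dyadic_def)
  qed
qed simp

lemma dyadic_integral:
  "integrable (lebesgue_on {0..1}) (indicator (dyadic k) :: real \<Rightarrow> real)"
  "(LINT x|lebesgue_on {0..1}. indicator (dyadic k) x :: real) = 1 / 2 ^ Suc k"
  using LINT_indicator_unit[of "1 / 2 ^ Suc k" "1 / 2 ^ k"]
  by (simp_all add: dyadic_def field_simps)

lemma sum_dyadic_powr: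
  fixes c :: "nat \<Rightarrow> real"
  assumes K: "finite K" and "0 < p"
  shows "\<bar>\<Sum>k\<in>K. c k * indicator (dyadic k) x\<bar> powr p = (\<Sum>k\<in>K. \<bar>c k\<bar> powr p * indicator (dyadic k) x)"
proof (cases "\<exists>k\<in>K. x \<in> dyadic k")
  case True
  then obtain k where k: "k \<in> K" "x \<in> dyadic k" by blast
  have "{j \<in> K. x \<in> dyadic j} = {k}" using dyadic_disjoint k by blast
  then show ?thesis using K by (simp add: indicator_def if_distrib sum.If_cases Int_def cong: if_cong)
next
  case False
  then have "indicator (dyadic k) x = (0 :: real)" if "k \<in> K" for k using that by auto
  then show ?thesis using assms by simp
qed

text \<open>The power of 2 makes each summand a unit vector of L_p. For disjoint supports p-th
  powers of norms add up.\<close>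

lemma Lp_norm_dyadic_sum:
  fixes p :: real
  assumes p: "1 \<le> p" and K: "finite K" and \<epsilon>: "\<And>k. k \<in> K \<Longrightarrow> \<bar>\<epsilon> k\<bar> = 1"
  defines "g \<equiv> \<lambda>x. \<Sum>k\<in>K. \<epsilon> k * (2 powr (real (Suc k) / p) * indicator (dyadic k) x)"
  shows "g \<in> Lp_space p" "Lp_norm p g = real (card K) powr (1 / p)"
proof -
  have pw: "\<bar>g x\<bar> powr p = (\<Sum>k\<in>K. 2 ^ Suc k * indicator (dyadic k) x)" for x
  proof -
    have "\<bar>g x\<bar> powr p = (\<Sum>k\<in>K. \<bar>\<epsilon> k * 2 powr (real (Suc k) / p)\<bar> powr p * indicator (dyadic k) x)"
      unfolding g_def mult.assoc[symmetric] using p K by (intro sum_dyadic_powr) auto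
    also have "\<dots> = (\<Sum>k\<in>K. 2 ^ Suc k * indicator (dyadic k) x)"
    proof (intro sum.cong refl)
      fix k assume k: "k \<in> K"
      have "\<bar>\<epsilon> k * 2 powr (real (Suc k) / p)\<bar> powr p = 2 powr real (Suc k)"
        using p \<epsilon>[OF k] by (simp add: abs_mult powr_powr del: of_nat_Suc)
      then show "\<bar>\<epsilon> k * 2 powr (real (Suc k) / p)\<bar> powr p * indicator (dyadic k) x
          = 2 ^ Suc k * indicator (dyadic k) x"
        by (simp add: powr_realpow del: of_nat_Suc power_Suc)
    qed
    finally show ?thesis .
  qed
  have "integrable (lebesgue_on {0..1}) g"
    unfolding g_def using dyadic_integral(1) by (intro Bochner_Integration.integrable_sum integrable_mult_right) auto
  moreover have int: "integrable (lebesgue_on {0..1}) (\<lambda>x. \<bar>g x\<bar> powr p)"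
    unfolding pw using dyadic_integral(1) by (intro Bochner_Integration.integrable_sum integrable_mult_right) auto
  ultimately show "g \<in> Lp_space p" by (auto simp: Lp_space_def)
  have "(LINT x|lebesgue_on {0..1}. \<bar>g x\<bar> powr p)
      = (\<Sum>k\<in>K. 2 ^ Suc k * (LINT x|lebesgue_on {0..1}. indicator (dyadic k) x))"
    unfolding pw using dyadic_integral(1)
    by (subst Bochner_Integration.integral_sum) (auto simp del: integral_indicator)
  also have "\<dots> = real (card K)" unfolding dyadic_integral(2) by simp
  finally show "Lp_norm p g = real (card K) powr (1 / p)" by (simp add: Lp_norm_def)
qed

section \<open>Orthonormal cosines, for larger exponents\<close>

lemma LINT_cos:
  fixes n :: int
  shows "(LINT x|lebesgue_on {0..1}. cos (2 * pi * n * x)) = (if n = 0 then 1 else 0)"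
proof (cases "n = 0")
  case True
  then show ?thesis using integral_const_unit(2)[of 1] by simp
next
  case False
  let ?F = "\<lambda>x. sin (2 * pi * n * x) / (2 * pi * n)"
  have "((\<lambda>x. cos (2 * pi * n * x)) has_integral ?F 1 - ?F 0) {0..1}"
  proof (rule fundamental_theorem_of_calculus)
    fix x :: real
    have "(?F has_real_derivative cos (2 * pi * n * x)) (at x within {0..1})"
      using False by (auto intro!: derivative_eq_intros)
    then show "(?F has_vector_derivative cos (2 * pi * n * x)) (at x within {0..1})"
      by (simp add: has_real_derivative_iff_has_vector_derivative)
  qed simp
  moreover have "?F 1 - ?F 0 = 0" using sin_int_2pin[of n] by (simp add: mult.assoc)
  ultimately have "integral {0..1} (\<lambda>x. cos (2 * pi * n * x)) = 0" by (metis integral_unique)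
  moreover have "integrable (lebesgue_on {0..1}) (\<lambda>x. cos (2 * pi * n * x))"
    by (intro continuous_imp_integrable_real continuous_intros)
  ultimately show ?thesis using False by (subst lebesgue_integral_eq_integral) auto
qed

text \<open>The frequencies start at 1, so that the factor \<open>sqrt 2\<close> normalizes every
  member.\<close>

definition cosine :: "nat \<Rightarrow> real \<Rightarrow> real" where
  "cosine k x = sqrt 2 * cos (2 * pi * real (Suc k) * x)"

lemma LINT_cosine_mult:
  "(LINT x|lebesgue_on {0..1}. cosine j x * cosine k x) = (if j = k then 1 else 0)"
proof -
  have "cosine j x * cosine k x = cos (2 * pi * of_int (int j - int k) * x)
      + cos (2 * pi * of_int (int j + int k + 2) * x)" for x
  proof -
    have "cosine j x * cosine k x = 2 * (cos (2 * pi * real (Suc j) * x) * cos (2 * pi * real (Suc k) * x))"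
      by (simp add: cosine_def)
    also have "\<dots> = cos (2 * pi * real (Suc j) * x - 2 * pi * real (Suc k) * x)
        + cos (2 * pi * real (Suc j) * x + 2 * pi * real (Suc k) * x)"
      unfolding cos_times_cos by simp
    finally show ?thesis by (simp add: algebra_simps)
  qed
  then have "(LINT x|lebesgue_on {0..1}. cosine j x * cosine k x)
    = (LINT x|lebesgue_on {0..1}. cos (2 * pi * of_int (int j - int k) * x)
      + cos (2 * pi * of_int (int j + int k + 2) * x))" by simp
  also have "\<dots> = (LINT x|lebesgue_on {0..1}. cos (2 * pi * of_int (int j - int k) * x))
      + (LINT x|lebesgue_on {0..1}. cos (2 * pi * of_int (int j + int k + 2) * x))"
    by (intro Bochner_Integration.integral_add continuous_imp_integrable_real continuous_intros)
  also have "\<dots> = (if j = k then 1 else 0)" unfolding LINT_cos by auto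
  finally show ?thesis .
qed

lemma powr_above_tangent:
  fixes r s M :: real
  assumes r: "1 \<le> r" and s: "0 \<le> s" and M: "0 < M"
  shows "M powr r + r * M powr (r - 1) * (s - M) \<le> s powr r"
proof (cases "s = 0")
  case True
  have "M powr (r - 1) * M = M powr r" using M powr_add[of M "r - 1" 1] by simp
  then have "M powr r + r * M powr (r - 1) * (s - M) = (1 - r) * M powr r"
    using True by (simp add: algebra_simps)
  also have "\<dots> \<le> 0" using r by (intro mult_nonpos_nonneg) auto
  finally show ?thesis using True by simp
next
  case False
  have "s powr r - M powr r \<ge> r * M powr (r - 1) * (s - M)"
    using False s M
    by (intro convex_on_imp_above_tangent[OF powr_convex[OF r]])
       (auto intro!: DERIV_subset[OF has_real_derivative_powr] simp: interior_open)
  then show ?thesis by simp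
qed

text \<open>Orthonormality gives the L_2 norm, which on a space of measure 1 is at most the L_p
  norm. The crude supremum bound suffices for the upper estimate, because the maps built from it
  only have to be Lipschitz.\<close>

lemma Lp_norm_cosine_sum:
  fixes p :: real
  assumes p: "2 \<le> p" and K: "finite K" and \<epsilon>: "\<And>k. k \<in> K \<Longrightarrow> \<bar>\<epsilon> k\<bar> = 1"
  defines "g \<equiv> \<lambda>x. \<Sum>k\<in>K. \<epsilon> k * cosine k x"
  shows "g \<in> Lp_space p" "real (card K) powr (1 / 2) \<le> Lp_norm p g" "Lp_norm p g \<le> 2 * real (card K)"
proof -
  have cont: "continuous_on A g" for A
    unfolding g_def cosine_def by (intro continuous_intros)
  have cont_p: "continuous_on {0..1} (\<lambda>x. \<bar>g x\<bar> powr p)"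
    using p by (intro continuous_on_powr' continuous_on_rabs cont continuous_on_const) auto
  then have int_p: "integrable (lebesgue_on {0..1}) (\<lambda>x. \<bar>g x\<bar> powr p)"
    by (rule continuous_imp_integrable_real)
  then show "g \<in> Lp_space p"
    using cont by (auto simp: Lp_space_def intro!: continuous_imp_measurable_on_sets_lebesgue)
  have int_2: "integrable (lebesgue_on {0..1}) (\<lambda>x. (g x)\<^sup>2)"
    by (intro continuous_imp_integrable_real continuous_intros cont)
  have "(LINT x|lebesgue_on {0..1}. (g x)\<^sup>2)
      = (LINT x|lebesgue_on {0..1}. (\<Sum>j\<in>K. \<Sum>k\<in>K. \<epsilon> j * \<epsilon> k * (cosine j x * cosine k x)))"
    by (simp add: g_def power2_eq_square sum_product algebra_simps)
  also have "\<dots> = (\<Sum>j\<in>K. \<Sum>k\<in>K. \<epsilon> j * \<epsilon> k * (LINT x|lebesgue_on {0..1}. cosine j x * cosine k x))"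
  proof -
    have *: "integrable (lebesgue_on {0..1}) (\<lambda>x. cosine j x * cosine k x)" for j k
      unfolding cosine_def by (intro continuous_imp_integrable_real continuous_intros)
    show ?thesis
      by (subst Bochner_Integration.integral_sum, use * in force)
         (intro sum.cong refl, subst Bochner_Integration.integral_sum, use * in auto)
  qed
  also have "\<dots> = (\<Sum>j\<in>K. \<epsilon> j * \<epsilon> j)"
    unfolding LINT_cosine_mult using K by (simp add: if_distrib cong: if_cong)
  also have "\<dots> = (\<Sum>j\<in>K. 1)"
  proof (intro sum.cong refl)
    fix j assume "j \<in> K"
    then have "\<bar>\<epsilon> j\<bar> * \<bar>\<epsilon> j\<bar> = 1" using \<epsilon> by simp
    then show "\<epsilon> j * \<epsilon> j = 1" by simp
  qed
  finally have L2: "(LINT x|lebesgue_on {0..1}. (g x)\<^sup>2) = real (card K)" by simp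
  show "real (card K) powr (1 / 2) \<le> Lp_norm p g"
  proof (cases "card K = 0")
    case False
    define M r where "M = real (card K)" and "r = p / 2"
    have M: "0 < M" and r: "1 \<le> r" using False p by (auto simp: M_def r_def)
    \<comment> \<open>This is Jensen's inequality: \<open>M\<close> is the mean of the square of
      \<open>g\<close>, so the linear term of the tangent at \<open>M\<close> integrates to
      0.\<close>
    have "M powr r = (LINT x|lebesgue_on {0..1}. M powr r + r * M powr (r - 1) * ((g x)\<^sup>2 - M))"
      using int_2 L2 integral_const_unit(2)[of 1] by (simp add: M_def)
    also have "\<dots> \<le> (LINT x|lebesgue_on {0..1}. \<bar>g x\<bar> powr p)"
    proof (rule integral_mono[OF _ int_p])
      show "integrable (lebesgue_on {0..1}) (\<lambda>x. M powr r + r * M powr (r - 1) * ((g x)\<^sup>2 - M))"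
        using int_2 integral_const_unit(1)
        by (intro Bochner_Integration.integrable_add integrable_mult_right Bochner_Integration.integrable_diff) auto
      fix x
      have "((g x)\<^sup>2) powr r = \<bar>g x\<bar> powr p"
      proof -
        have "(g x)\<^sup>2 = \<bar>g x\<bar> powr 2" by (cases "g x = 0") simp_all
        then show ?thesis by (simp only: powr_powr r_def) simp
      qed
      then show "M powr r + r * M powr (r - 1) * ((g x)\<^sup>2 - M) \<le> \<bar>g x\<bar> powr p"
        using powr_above_tangent[OF r _ M, of "(g x)\<^sup>2"] by simp
    qed
    finally have "(M powr r) powr (1 / p) \<le> Lp_norm p g"
      unfolding Lp_norm_def using p by (intro powr_mono2) auto
    moreover have "(M powr r) powr (1 / p) = M powr (1 / 2)" using p by (simp add: powr_powr r_def)
    ultimately show ?thesis by (simp add: M_def)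
  qed (simp add: Lp_norm_def)
  have bound: "\<bar>g x\<bar> \<le> 2 * real (card K)" for x
  proof -
    have "\<bar>g x\<bar> \<le> (\<Sum>k\<in>K. \<bar>\<epsilon> k * cosine k x\<bar>)" unfolding g_def by (rule sum_abs)
    also have "\<dots> \<le> (\<Sum>k\<in>K. 2)"
    proof (rule sum_mono)
      fix k assume "k \<in> K"
      have "sqrt 2 * \<bar>cos (2 * pi * real (Suc k) * x)\<bar> \<le> 2 * 1"
        by (intro mult_mono abs_cos_le_one) (auto intro: real_le_lsqrt)
      then show "\<bar>\<epsilon> k * cosine k x\<bar> \<le> 2" using \<epsilon>[OF \<open>k \<in> K\<close>] by (simp add: abs_mult cosine_def)
    qed
    finally show ?thesis by simp
  qed
  have "(LINT x|lebesgue_on {0..1}. \<bar>g x\<bar> powr p) \<le> (LINT x|lebesgue_on {0..1::real}. (2 * real (card K)) powr p)"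
    using bound p by (intro integral_mono int_p integral_const_unit(1) powr_mono2) auto
  then have "Lp_norm p g \<le> ((2 * real (card K)) powr p) powr (1 / p)"
    unfolding Lp_norm_def integral_const_unit(2) using p by (intro powr_mono2 integral_nonneg) auto
  then show "Lp_norm p g \<le> 2 * real (card K)" using p by (simp add: powr_powr)
qed

lemma Lp_unconditional_system:
  fixes p :: real
  assumes p: "1 \<le> p"
  obtains \<phi> :: "nat \<Rightarrow> real \<Rightarrow> real" where
    "\<And>K \<epsilon>. finite K \<Longrightarrow> (\<And>k. k \<in> K \<Longrightarrow> \<bar>\<epsilon> k\<bar> = 1) \<Longrightarrow> (\<lambda>x. \<Sum>k\<in>K. \<epsilon> k * \<phi> k x) \<in> Lp_space p"
    "\<And>K \<epsilon>. finite K \<Longrightarrow> (\<And>k. k \<in> K \<Longrightarrow> \<bar>\<epsilon> k\<bar> = 1) \<Longrightarrow>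
       real (card K) powr max (1 / p) (1 / 2) \<le> Lp_norm p (\<lambda>x. \<Sum>k\<in>K. \<epsilon> k * \<phi> k x)"
    "\<And>K \<epsilon>. finite K \<Longrightarrow> (\<And>k. k \<in> K \<Longrightarrow> \<bar>\<epsilon> k\<bar> = 1) \<Longrightarrow>
       Lp_norm p (\<lambda>x. \<Sum>k\<in>K. \<epsilon> k * \<phi> k x) \<le> 2 * real (card K)"
proof (cases "p \<le> 2")
  case True
  have m: "max (1 / p) (1 / 2) = 1 / p" using True p by (simp add: field_simps)
  have le: "real n powr (1 / p) \<le> 2 * real n" for n
  proof (cases "n = 0")
    case False
    then have "real n powr (1 / p) \<le> real n powr 1" using p by (intro powr_mono) auto
    then show ?thesis by simp
  qed simp
  show ?thesis
    by (rule that[of "\<lambda>k x. 2 powr (real (Suc k) / p) * indicator (dyadic k) x"])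
       (use Lp_norm_dyadic_sum[OF p] le m in auto)
next
  case False
  have m: "max (1 / p) (1 / 2) = 1 / 2" using False by (simp add: field_simps)
  show ?thesis
    by (rule that[of cosine]) (use Lp_norm_cosine_sum[of p] False m in auto)
qed

section \<open>Word lengths\<close>

context group
begin

lemma foldr_mult_closed: "set w \<subseteq> carrier G \<Longrightarrow> foldr (mult G) w \<one> \<in> carrier G"
  by (induction w) auto

lemma foldr_mult_append:
  "set v \<subseteq> carrier G \<Longrightarrow> set w \<subseteq> carrier G \<Longrightarrow>
    foldr (mult G) (v @ w) \<one> = foldr (mult G) v \<one> \<otimes> foldr (mult G) w \<one>"
  by (induction v) (auto simp: m_assoc foldr_mult_closed simp del: foldr_append)

lemma generate_imp_word:
  assumes S: "S \<subseteq> carrier G" and "x \<in> generate G S"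
  shows "\<exists>w. set w \<subseteq> S \<union> m_inv G ` S \<and> foldr (mult G) w \<one> = x"
  using assms(2)
proof induction
  case one
  then show ?case by (intro exI[of _ "[]"]) simp
next
  case (incl h)
  then show ?case using S by (intro exI[of _ "[h]"]) auto
next
  case (inv h)
  then show ?case using S by (intro exI[of _ "[inv h]"]) auto
next
  case (eng h1 h2)
  then obtain v w where "set v \<subseteq> S \<union> m_inv G ` S" "foldr (mult G) v \<one> = h1"
    "set w \<subseteq> S \<union> m_inv G ` S" "foldr (mult G) w \<one> = h2" by blast
  moreover have "S \<union> m_inv G ` S \<subseteq> carrier G" using S by auto
  ultimately show ?case using foldr_mult_append[of v w]
    by (intro exI[of _ "v @ w"]) (simp del: foldr_append, blast)
qed

lemma word_length_word:
  assumes S: "finite_generating_set G S" and x: "x \<in> carrier G"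
  obtains w where "length w = word_length G S x" "set w \<subseteq> S \<union> m_inv G ` S" "foldr (mult G) w \<one> = x"
proof -
  have "\<exists>n w. length w = n \<and> set w \<subseteq> S \<union> m_inv G ` S \<and> foldr (mult G) w \<one> = x"
    using generate_imp_word[of S x] S x by (auto simp: finite_generating_set_def)
  from LeastI_ex[OF this] that show ?thesis unfolding word_length_def by blast
qed

lemma word_length_le:
  "set w \<subseteq> S \<union> m_inv G ` S \<Longrightarrow> word_length G S (foldr (mult G) w \<one>) \<le> length w"
  unfolding word_length_def by (intro Least_le) blast

lemma word_length_mult:
  assumes S: "finite_generating_set G S" and "x \<in> carrier G" "y \<in> carrier G"
  shows "word_length G S (x \<otimes> y) \<le> word_length G S x + word_length G S y"
proof -
  obtain v w where v: "length v = word_length G S x" "set v \<subseteq> S \<union> m_inv G ` S" "foldr (mult G) v \<one> = x"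
    and w: "length w = word_length G S y" "set w \<subseteq> S \<union> m_inv G ` S" "foldr (mult G) w \<one> = y"
    using word_length_word[OF S] assms by metis
  have "S \<union> m_inv G ` S \<subseteq> carrier G" using S by (auto simp: finite_generating_set_def)
  then have "foldr (mult G) (v @ w) \<one> = x \<otimes> y" using v w foldr_mult_append[of v w] by auto
  then show ?thesis using word_length_le[of "v @ w" S] v w by simp
qed

lemma word_length_eq_0:
  assumes S: "finite_generating_set G S" and "x \<in> carrier G" "word_length G S x = 0"
  shows "x = \<one>"
  using word_length_word[OF assms(1,2)] assms(3) by (metis foldr_Nil id_apply length_0_conv)

lemma countable_carrier:
  assumes S: "finite_generating_set G S" shows "countable (carrier G)"
proof -
  have "carrier G \<subseteq> (\<lambda>w. foldr (mult G) w \<one>) ` lists (S \<union> m_inv G ` S)"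
  proof
    fix x assume "x \<in> carrier G"
    then obtain w where "set w \<subseteq> S \<union> m_inv G ` S" "foldr (mult G) w \<one> = x"
      using word_length_word[OF S] by blast
    then show "x \<in> (\<lambda>w. foldr (mult G) w \<one>) ` lists (S \<union> m_inv G ` S)" by (auto simp: lists_eq_set)
  qed
  moreover have "countable (S \<union> m_inv G ` S)"
    using S by (auto simp: finite_generating_set_def intro!: countable_finite)
  ultimately show ?thesis by (meson countable_image countable_lists countable_subset)
qed

end

context regular_tree
begin

text \<open>The left factor of a product is applied first, hence the order of the
  composition.\<close>

lemma word_dist_eq:
  "x \<in> carrier (DA q) \<Longrightarrow> word_dist (DA q) S x y = real (word_length (DA q) S (y \<circ> pinv x))"
  by (simp add: word_dist_def DA_m_inv)

lemma quotient_DA: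
  "x \<in> carrier (DA q) \<Longrightarrow> y \<in> carrier (DA q) \<Longrightarrow> y \<circ> pinv x \<in> carrier (DA q)"
  using DA_m_inv[of x] group.inv_closed[OF group_DA, of x] DA_comp[of "pinv x" y] by simp

lemma quotient_comp: "x \<in> carrier (DA q) \<Longrightarrow> (y \<circ> pinv x) \<circ> x = y"
  using Aff_inv_left[OF DA_Aff] by (simp add: fun_eq_iff)

text \<open>Left invariance reduces to the distance from the identity. There each letter adds at
  most \<open>C\<close>, by the triangle inequality and invariance again.\<close>

lemma card_diff_edges_le_word_length:
  assumes S: "finite_generating_set (DA q) S"
  obtains C where
    "\<And>x y. x \<in> carrier (DA q) \<Longrightarrow> y \<in> carrier (DA q) \<Longrightarrow>
      card (diff_edges x y) \<le> C * word_length (DA q) S (y \<circ> pinv x)"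
proof -
  interpret D: group "DA q" by (rule group_DA)
  let ?T = "S \<union> m_inv (DA q) ` S"
  \<comment> \<open>The inserted 0 keeps the maximum meaningful for an empty set of letters.\<close>
  define C where "C = Max (insert 0 ((\<lambda>s. card (diff_edges id s)) ` ?T))"
  have fin: "finite ?T" and T: "?T \<subseteq> carrier (DA q)" using S by (auto simp: finite_generating_set_def)
  have C: "card (diff_edges id s) \<le> C" if "s \<in> ?T" for s
    unfolding C_def using that fin by (intro Max_ge) auto
  have id: "id \<in> carrier (DA q)" using D.one_closed by simp
  have word: "card (diff_edges id (foldr (mult (DA q)) w \<one>\<^bsub>DA q\<^esub>)) \<le> C * length w" if "set w \<subseteq> ?T" for w
    using that
  proof (induction w)
    case Nil
    then show ?case by (simp add: diff_edges_def)
  next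
    case (Cons s w)
    define r where "r = foldr (mult (DA q)) w \<one>\<^bsub>DA q\<^esub>"
    have s: "s \<in> carrier (DA q)" "s \<in> ?T" using Cons.prems T by auto
    have "set w \<subseteq> ?T" using Cons.prems by simp
    from Cons.IH[OF this] have IH: "card (diff_edges id r) \<le> C * length w" unfolding r_def .
    have "set w \<subseteq> carrier (DA q)" using Cons.prems T by auto
    then have r: "r \<in> carrier (DA q)" unfolding r_def by (rule D.foldr_mult_closed)
    have rs: "r \<circ> s \<in> carrier (DA q)" using DA_comp[OF s(1) r] .
    have "card (diff_edges id (r \<circ> s)) \<le> card (diff_edges id s \<union> diff_edges s (r \<circ> s))"
      using finite_diff_edges id s rs by (intro card_mono diff_edges_triangle) auto
    also have "\<dots> \<le> card (diff_edges id s) + card (diff_edges s (r \<circ> s))" by (rule card_Un_le)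
    also have "card (diff_edges s (r \<circ> s)) = card (diff_edges id r)"
      using card_diff_edges_comp[OF DA_Aff[OF s(1)] DA_Aff[OF id] DA_Aff[OF r]] by simp
    also have "card (diff_edges id s) + card (diff_edges id r) \<le> C + C * length w"
      using C[OF s(2)] IH by (rule add_mono)
    also have "C + C * length w = C * length (s # w)" by simp
    finally have "card (diff_edges id (r \<circ> s)) \<le> C * length (s # w)" .
    moreover have "foldr (mult (DA q)) (s # w) \<one>\<^bsub>DA q\<^esub> = r \<circ> s"
      unfolding DA_mult[symmetric] r_def foldr_Cons comp_apply ..
    ultimately show ?case by (simp only:)
  qed
  show ?thesis
  proof (rule that)
    fix x y assume x: "x \<in> carrier (DA q)" and y: "y \<in> carrier (DA q)"
    have g: "y \<circ> pinv x \<in> carrier (DA q)" using quotient_DA[OF x y] .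
    obtain w where w: "length w = word_length (DA q) S (y \<circ> pinv x)" "set w \<subseteq> ?T"
      "foldr (mult (DA q)) w \<one>\<^bsub>DA q\<^esub> = y \<circ> pinv x"
      using D.word_length_word[OF S g] by blast
    have "card (diff_edges x y) = card (diff_edges (id \<circ> x) ((y \<circ> pinv x) \<circ> x))"
      unfolding quotient_comp[OF x] by simp
    also have "\<dots> = card (diff_edges id (y \<circ> pinv x))"
      by (rule card_diff_edges_comp) (use DA_Aff x id g in auto)
    also have "\<dots> \<le> C * word_length (DA q) S (y \<circ> pinv x)" using word[OF w(2)] unfolding w by simp
    finally show "card (diff_edges x y) \<le> C * word_length (DA q) S (y \<circ> pinv x)" .
  qed
qed

text \<open>The summand 1 accounts for distinct elements without differing edges: they differ only
  by the local permutation at their common position.\<close>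

lemma word_dist_diff_edges:
  assumes S: "finite_generating_set (DA q) S"
  obtains C :: real where "1 \<le> C"
    "\<And>x y. x \<in> carrier (DA q) \<Longrightarrow> y \<in> carrier (DA q) \<Longrightarrow>
      real (card (diff_edges x y)) \<le> C * word_dist (DA q) S x y"
    "\<And>x y. x \<in> carrier (DA q) \<Longrightarrow> y \<in> carrier (DA q) \<Longrightarrow>
      word_dist (DA q) S x y \<le> C * (real (card (diff_edges x y)) + 1)"
proof -
  let ?L = "word_length (DA q) S"
  obtain C1 where C1: "\<And>x y. x \<in> carrier (DA q) \<Longrightarrow> y \<in> carrier (DA q) \<Longrightarrow>
      card (diff_edges x y) \<le> C1 * ?L (y \<circ> pinv x)"
    using card_diff_edges_le_word_length[OF S] by metis
  define K where "K = Max (?L ` gens)"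
  have K: "?L t \<le> K" if "t \<in> gens" for t unfolding K_def using that finite_gens by (intro Max_ge) auto
  have sub: "?L (b \<circ> a) \<le> ?L a + ?L b" if "a \<in> carrier (DA q)" "b \<in> carrier (DA q)" for a b
    using group.word_length_mult[OF group_DA S that] by simp
  define C where "C = real C1 + 4 * real K + 1"
  show ?thesis
  proof (rule that[of C])
    fix x y assume x: "x \<in> carrier (DA q)" and y: "y \<in> carrier (DA q)"
    have "real (card (diff_edges x y)) \<le> real C1 * real (?L (y \<circ> pinv x))"
      using C1[OF x y] by (simp flip: of_nat_mult)
    also have "\<dots> \<le> C * word_dist (DA q) S x y"
      unfolding word_dist_eq[OF x] by (intro mult_right_mono) (auto simp: C_def)
    finally show "real (card (diff_edges x y)) \<le> C * word_dist (DA q) S x y" .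
    have "?L (y \<circ> pinv x) \<le> K * (4 * card (diff_edges x y) + 1)"
      using length_le_diff_edges[of ?L K, OF sub K x y] .
    then have "real (?L (y \<circ> pinv x)) \<le> real (K * (4 * card (diff_edges x y) + 1))"
      by (rule of_nat_mono)
    also have "\<dots> = real K * (4 * real (card (diff_edges x y)) + 1)" by (simp add: distrib_left)
    also have "\<dots> \<le> real K * (4 * (real (card (diff_edges x y)) + 1))" by (intro mult_left_mono) auto
    also have "\<dots> \<le> C * (real (card (diff_edges x y)) + 1)"
      unfolding mult.assoc[symmetric] by (intro mult_right_mono) (auto simp: C_def)
    finally show "word_dist (DA q) S x y \<le> C * (real (card (diff_edges x y)) + 1)"
      unfolding word_dist_eq[OF x] .
  qed (simp add: C_def)
qed

lemma word_dist_ge_1: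
  assumes S: "finite_generating_set (DA q) S"
    and x: "x \<in> carrier (DA q)" and y: "y \<in> carrier (DA q)" and "x \<noteq> y"
  shows "1 \<le> word_dist (DA q) S x y"
proof -
  have "y \<circ> pinv x \<noteq> \<one>\<^bsub>DA q\<^esub>" using quotient_comp[OF x, of y] \<open>x \<noteq> y\<close> by auto
  then have "word_length (DA q) S (y \<circ> pinv x) \<noteq> 0"
    using group.word_length_eq_0[OF group_DA S quotient_DA[OF x y]] by blast
  then show ?thesis unfolding word_dist_eq[OF x] by linarith
qed

end

section \<open>Embedding families of sets\<close>

definition symdiff :: "'a set \<Rightarrow> 'a set \<Rightarrow> 'a set" where
  "symdiff A B = {a. (a \<in> A) \<noteq> (a \<in> B)}"

text \<open>The sets may be infinite, so the indicator function of \<open>A x\<close> is expanded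
  relative to a base set \<open>A x0\<close>, which leaves finite sums. Countability of
  \<open>E\<close> makes the indices that occur enumerable by the sequence in L_p.\<close>

lemma Lp_embedding_of_sets:
  fixes p :: real and A :: "'a \<Rightarrow> 'b set"
  assumes p: "1 \<le> p" and E: "countable E"
    and fin: "\<And>x y. x \<in> E \<Longrightarrow> y \<in> E \<Longrightarrow> finite (symdiff (A x) (A y))"
  obtains f where "\<And>x. x \<in> E \<Longrightarrow> f x \<in> Lp_space p"
    "\<And>x y. x \<in> E \<Longrightarrow> y \<in> E \<Longrightarrow>
       real (card (symdiff (A x) (A y))) powr max (1 / p) (1 / 2) \<le> Lp_dist p (f x) (f y)"
    "\<And>x y. x \<in> E \<Longrightarrow> y \<in> E \<Longrightarrow> Lp_dist p (f x) (f y) \<le> 2 * real (card (symdiff (A x) (A y)))"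
proof (cases "E = {}")
  case True
  then show ?thesis using that by blast
next
  case False
  then obtain x0 where x0: "x0 \<in> E" by blast
  obtain \<phi> :: "nat \<Rightarrow> real \<Rightarrow> real" where
    \<phi>: "\<And>K \<epsilon>. finite K \<Longrightarrow> (\<And>k. k \<in> K \<Longrightarrow> \<bar>\<epsilon> k\<bar> = 1) \<Longrightarrow> (\<lambda>x. \<Sum>k\<in>K. \<epsilon> k * \<phi> k x) \<in> Lp_space p"
    "\<And>K \<epsilon>. finite K \<Longrightarrow> (\<And>k. k \<in> K \<Longrightarrow> \<bar>\<epsilon> k\<bar> = 1) \<Longrightarrow>
       real (card K) powr max (1 / p) (1 / 2) \<le> Lp_norm p (\<lambda>x. \<Sum>k\<in>K. \<epsilon> k * \<phi> k x)"
    "\<And>K \<epsilon>. finite K \<Longrightarrow> (\<And>k. k \<in> K \<Longrightarrow> \<bar>\<epsilon> k\<bar> = 1) \<Longrightarrow>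
       Lp_norm p (\<lambda>x. \<Sum>k\<in>K. \<epsilon> k * \<phi> k x) \<le> 2 * real (card K)"
    using Lp_unconditional_system[OF p] by blast
  define \<Delta> where "\<Delta> x y = symdiff (A x) (A y)" for x y
  define ind where "ind x a = (if a \<in> A x then 1 else 0 :: real)" for x a
  define U where "U = (\<Union>x\<in>E. \<Delta> x x0)"
  have "countable U" unfolding U_def \<Delta>_def
    using E fin[OF _ x0] countable_finite by (intro countable_UN) auto
  define e where "e = to_nat_on U"
  have inj: "inj_on e U" unfolding e_def using \<open>countable U\<close> by (rule inj_on_to_nat_on)
  define f where "f x t = (\<Sum>a\<in>\<Delta> x x0. (ind x a - ind x0 a) * \<phi> (e a) t)" for x t
  have finD: "finite (\<Delta> x y)" if "x \<in> E" "y \<in> E" for x y using fin that by (simp add: \<Delta>_def)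
  \<comment> \<open>Over a common finite index set the contribution of the base point
    cancels.\<close>
  have diff: "f x t - f y t = (\<Sum>a\<in>\<Delta> x y. (ind x a - ind y a) * \<phi> (e a) t)"
    if x: "x \<in> E" and y: "y \<in> E" for x y t
  proof -
    let ?W = "\<Delta> x x0 \<union> \<Delta> y x0"
    have W: "finite ?W" using finD x y x0 by simp
    have "f z t = (\<Sum>a\<in>?W. (ind z a - ind x0 a) * \<phi> (e a) t)" if "z = x \<or> z = y" for z
      unfolding f_def by (rule sum.mono_neutral_left[OF W]) (use that in \<open>auto simp: \<Delta>_def symdiff_def ind_def\<close>)
    then have "f x t - f y t = (\<Sum>a\<in>?W. (ind x a - ind y a) * \<phi> (e a) t)"
      by (simp add: algebra_simps flip: sum_subtractf)
    also have "\<dots> = (\<Sum>a\<in>\<Delta> x y. (ind x a - ind y a) * \<phi> (e a) t)"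
      by (rule sum.mono_neutral_right[OF W]) (auto simp: \<Delta>_def symdiff_def ind_def)
    finally show ?thesis .
  qed
  have *: "(\<Sum>a\<in>\<Delta> x y. (ind x a - ind y a) * \<phi> (e a) t)
      = (\<Sum>k\<in>e ` \<Delta> x y. (ind x (inv_into U e k) - ind y (inv_into U e k)) * \<phi> k t)"
    "card (e ` \<Delta> x y) = card (\<Delta> x y)"
    "\<And>k. k \<in> e ` \<Delta> x y \<Longrightarrow> \<bar>ind x (inv_into U e k) - ind y (inv_into U e k)\<bar> = 1"
    if x: "x \<in> E" and y: "y \<in> E" for x y t
  proof -
    have sub: "\<Delta> x y \<subseteq> U" using x y by (auto simp: U_def \<Delta>_def symdiff_def)
    then have inj': "inj_on e (\<Delta> x y)" using inj inj_on_subset by blast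
    then show "card (e ` \<Delta> x y) = card (\<Delta> x y)" by (rule card_image)
    have inv: "inv_into U e (e a) = a" if "a \<in> \<Delta> x y" for a using that sub inj by (intro inv_into_f_f) auto
    then show "(\<Sum>a\<in>\<Delta> x y. (ind x a - ind y a) * \<phi> (e a) t)
      = (\<Sum>k\<in>e ` \<Delta> x y. (ind x (inv_into U e k) - ind y (inv_into U e k)) * \<phi> k t)"
      using inj' by (simp add: sum.reindex)
    show "\<bar>ind x (inv_into U e k) - ind y (inv_into U e k)\<bar> = 1" if "k \<in> e ` \<Delta> x y" for k
      using that inv by (auto simp: \<Delta>_def symdiff_def ind_def)
  qed
  show ?thesis
  proof (rule that[of f])
    fix x assume x: "x \<in> E"
    have fx: "f x = (\<lambda>t. \<Sum>k\<in>e ` \<Delta> x x0. (ind x (inv_into U e k) - ind x0 (inv_into U e k)) * \<phi> k t)"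
      using *(1)[OF x x0] by (simp add: f_def fun_eq_iff)
    show "f x \<in> Lp_space p" unfolding fx
      by (rule \<phi>(1)[of "e ` \<Delta> x x0" "\<lambda>k. ind x (inv_into U e k) - ind x0 (inv_into U e k)"]) (use finD[OF x x0] *(3)[OF x x0] in auto)
    fix y assume y: "y \<in> E"
    let ?g = "\<lambda>t. \<Sum>k\<in>e ` \<Delta> x y. (ind x (inv_into U e k) - ind y (inv_into U e k)) * \<phi> k t"
    have d: "Lp_dist p (f x) (f y) = Lp_norm p ?g"
      unfolding Lp_dist_def diff[OF x y] *(1)[OF x y] ..
    show "real (card (symdiff (A x) (A y))) powr max (1 / p) (1 / 2) \<le> Lp_dist p (f x) (f y)"
      using \<phi>(2)[of "e ` \<Delta> x y" "\<lambda>k. ind x (inv_into U e k) - ind y (inv_into U e k)"] finD[OF x y] *(3)[OF x y] *(2)[OF x y]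
      unfolding d by (simp only: \<Delta>_def[symmetric] finite_imageI)
    show "Lp_dist p (f x) (f y) \<le> 2 * real (card (symdiff (A x) (A y)))"
      using \<phi>(3)[of "e ` \<Delta> x y" "\<lambda>k. ind x (inv_into U e k) - ind y (inv_into U e k)"] finD[OF x y] *(3)[OF x y] *(2)[OF x y]
      unfolding d by (simp only: \<Delta>_def[symmetric] finite_imageI)
  qed
qed

context regular_tree
begin

text \<open>The singleton \<open>{Inr x}\<close> separates elements that differ only by the local permutation
  at their common position, which no edge detects.\<close>

definition features :: "(vertex \<Rightarrow> vertex) \<Rightarrow>
    ((vertex \<times> bool \<times> (vertex \<Rightarrow> nat \<Rightarrow> nat)) + (vertex \<Rightarrow> vertex)) set" where
  "features x = insert (Inr x) (Inl ` (\<lambda>w. (w, view x w)) ` V)"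

lemma features_diff:
  assumes "x \<noteq> y"
  shows "features x - features y = insert (Inr x) (Inl ` (\<lambda>w. (w, view x w)) ` diff_edges x y)"
  using assms by (auto simp: features_def diff_edges_def image_iff)

text \<open>Each differing edge yields one pair on either side, and so do the two
  singletons.\<close>

lemma card_symdiff_features:
  assumes "x \<in> carrier (DA q)" "y \<in> carrier (DA q)" "x \<noteq> y"
  shows "finite (symdiff (features x) (features y))"
    "card (symdiff (features x) (features y)) = 2 * (card (diff_edges x y) + 1)"
proof -
  have *: "finite (features x - features y)" "card (features x - features y) = card (diff_edges x y) + 1"
    if "x \<in> carrier (DA q)" "y \<in> carrier (DA q)" "x \<noteq> y" for x y
  proof -
    have fin: "finite (diff_edges x y)" using finite_diff_edges that by blast
    then show "finite (features x - features y)" unfolding features_diff[OF that(3)] by simp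
    have "card (Inl ` (\<lambda>w. (w, view x w)) ` diff_edges x y) = card (diff_edges x y)"
      unfolding image_image by (rule card_image) (auto intro: inj_onI)
    moreover have "Inr x \<notin> Inl ` (\<lambda>w. (w, view x w)) ` diff_edges x y" by blast
    ultimately show "card (features x - features y) = card (diff_edges x y) + 1"
      unfolding features_diff[OF that(3)] using fin by simp
  qed
  define P Q where "P = features x - features y" and "Q = features y - features x"
  have PQ: "symdiff (features x) (features y) = P \<union> Q" by (auto simp: P_def Q_def symdiff_def)
  show "finite (symdiff (features x) (features y))" unfolding PQ using * assms by (auto simp: P_def Q_def)
  have "card (P \<union> Q) = card P + card Q"
    using * assms by (intro card_Un_disjoint) (auto simp: P_def Q_def)
  then show "card (symdiff (features x) (features y)) = 2 * (card (diff_edges x y) + 1)"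
    using *(2)[OF assms] *(2)[OF assms(2,1)] assms(3) diff_edges_commute[of x y]
    unfolding PQ P_def[symmetric] Q_def[symmetric] by simp
qed

lemma Lp_embedding_DA:
  fixes p :: real
  assumes p: "1 \<le> p" and S: "finite_generating_set (DA q) S"
  obtains f c where "lipschitz_into_Lp p (DA q) S f" "0 < c"
    "\<And>x y. x \<in> carrier (DA q) \<Longrightarrow> y \<in> carrier (DA q) \<Longrightarrow>
      c * word_dist (DA q) S x y powr max (1 / p) (1 / 2) \<le> Lp_dist p (f x) (f y)"
proof -
  let ?X = "carrier (DA q)" and ?d = "word_dist (DA q) S" and ?m = "max (1 / p) (1 / 2)"
  have m0: "0 \<le> ?m" by simp
  obtain C :: real where C: "1 \<le> C"
    "\<And>x y. x \<in> ?X \<Longrightarrow> y \<in> ?X \<Longrightarrow> real (card (diff_edges x y)) \<le> C * ?d x y"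
    "\<And>x y. x \<in> ?X \<Longrightarrow> y \<in> ?X \<Longrightarrow> ?d x y \<le> C * (real (card (diff_edges x y)) + 1)"
    using word_dist_diff_edges[OF S] by metis
  have fin: "finite (symdiff (features x) (features y))" if "x \<in> ?X" "y \<in> ?X" for x y
    using card_symdiff_features(1)[OF that] by (cases "x = y") (auto simp: symdiff_def)
  obtain f where f: "\<And>x. x \<in> ?X \<Longrightarrow> f x \<in> Lp_space p"
    "\<And>x y. x \<in> ?X \<Longrightarrow> y \<in> ?X \<Longrightarrow>
       real (card (symdiff (features x) (features y))) powr ?m \<le> Lp_dist p (f x) (f y)"
    "\<And>x y. x \<in> ?X \<Longrightarrow> y \<in> ?X \<Longrightarrow>
       Lp_dist p (f x) (f y) \<le> 2 * real (card (symdiff (features x) (features y)))"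
    using Lp_embedding_of_sets[where A = features, OF p group.countable_carrier[OF group_DA S] fin] by blast
  have d0: "0 \<le> ?d x y" for x y by (simp add: word_dist_def)
  show ?thesis
  proof (rule that[of f "C powr (- ?m)"])
    have "Lp_dist p (f x) (f y) \<le> 4 * (C + 1) * ?d x y" if x: "x \<in> ?X" and y: "y \<in> ?X" for x y
    proof (cases "x = y")
      case True
      then show ?thesis using f(3)[OF x y] d0[of x y] C(1) by (simp add: symdiff_def order_trans[OF _ mult_nonneg_nonneg])
    next
      case False
      have "Lp_dist p (f x) (f y) \<le> 4 * (real (card (diff_edges x y)) + 1)"
        using f(3)[OF x y] card_symdiff_features(2)[OF x y False] by simp
      \<comment> \<open>For distinct elements the distance is at least 1, which absorbs the additive
        term.\<close>
      also have "\<dots> \<le> 4 * (C * ?d x y + ?d x y)"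
        using C(2)[OF x y] word_dist_ge_1[OF S x y False] by simp
      finally show ?thesis by (simp add: algebra_simps)
    qed
    then show "lipschitz_into_Lp p (DA q) S f"
      unfolding lipschitz_into_Lp_def using f(1) by blast
    fix x y assume x: "x \<in> ?X" and y: "y \<in> ?X"
    show "C powr (- ?m) * ?d x y powr ?m \<le> Lp_dist p (f x) (f y)"
    proof (cases "x = y")
      case True
      then have "?d x y \<le> 0"
        using word_dist_eq[OF x, of S y] Aff_inv_right[OF DA_Aff[OF x]]
          group.word_length_le[OF group_DA, of "[]" S] by (auto simp: comp_def id_def)
      then have "?d x y = 0" using d0[of x y] by simp
      then show ?thesis by (simp add: Lp_dist_def Lp_norm_def)
    next
      case False
      have "?d x y powr ?m \<le> (C * real (card (symdiff (features x) (features y)))) powr ?m"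
      proof (rule powr_mono2[OF m0 d0])
        have "C * (real (card (diff_edges x y)) + 1) \<le> C * real (card (symdiff (features x) (features y)))"
          using card_symdiff_features(2)[OF x y False] C(1) by (intro mult_left_mono) auto
        then show "?d x y \<le> C * real (card (symdiff (features x) (features y)))"
          using C(3)[OF x y] by simp
      qed
      also have "\<dots> = C powr ?m * real (card (symdiff (features x) (features y))) powr ?m"
        using C(1) by (simp add: powr_mult)
      also have "\<dots> \<le> C powr ?m * Lp_dist p (f x) (f y)"
        using f(2)[OF x y] by (intro mult_left_mono) auto
      finally have "C powr (- ?m) * ?d x y powr ?m \<le> C powr (- ?m) * (C powr ?m * Lp_dist p (f x) (f y))"
        by (intro mult_left_mono) auto
      also have "\<dots> = Lp_dist p (f x) (f y)"
        using C(1) by (simp add: powr_minus)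
      finally show ?thesis .
    qed
  qed (use C(1) in simp)
qed

end

section \<open>Cubes in the discrete affine group\<close>

context regular_tree
begin

text \<open>\<open>leaf B\<close> lies \<open>n\<close> levels below \<open>omega_ray n\<close> if \<open>B \<subseteq> {..<n}\<close>; its digits 1 are at the
  places \<open>- i\<close>, \<open>i \<in> B\<close>.\<close>

definition leaf :: "nat set \<Rightarrow> vertex" where
  "leaf B = (0, \<lambda>k. if k \<le> 0 then (if nat (- k) \<in> B then 1 else 0) else undefined)"

lemma leaf_in_V:
  assumes "B \<subseteq> {..<n}" shows "leaf B \<in> V"
proof -
  have "\<forall>k\<le>- int n. (if k \<le> 0 then (if nat (- k) \<in> B then 1 else 0) else undefined) = (0::nat)"
    using assms by auto
  then show ?thesis using q2 unfolding leaf_def in_V_iff by (intro conjI exI[of _ "- int n"]) auto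
qed

lemma inj_leaf: "inj leaf"
proof (rule injI)
  fix A B assume e: "leaf A = leaf B"
  have "i \<in> A \<longleftrightarrow> i \<in> B" for i
    using fun_cong[OF arg_cong[OF e, of snd], of "- int i"] by (auto simp: leaf_def split: if_splits)
  then show "A = B" by blast
qed

lemma fst_leaf [simp]: "fst (leaf B) = 0"
  by (simp add: leaf_def)

lemma leaf_ancestor:
  assumes "B \<subseteq> {..<n}" shows "(ancestor ^^ n) (leaf B) = (ancestor ^^ n) orig"
proof -
  have "nat (- k) \<notin> B" if "k \<le> - int n" for k using assms that by auto
  then show ?thesis
    unfolding omega_ray_eq[symmetric] ancestor_pow[OF leaf_in_V[OF assms]]
    by (auto simp: leaf_def omega_ray_def restrict_def fun_eq_iff)
qed

definition leaves :: "nat \<Rightarrow> vertex set" where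
  "leaves n = leaf ` Pow {..<n}"

lemma finite_leaves: "finite (leaves n)" and card_leaves: "card (leaves n) = 2 ^ n"
  using card_image[OF inj_on_subset[OF inj_leaf subset_UNIV], of "Pow {..<n}"]
  by (auto simp: leaves_def card_Pow)

lemma leaves_V: "b \<in> leaves n \<Longrightarrow> b \<in> V" and leaves_level: "b \<in> leaves n \<Longrightarrow> fst b = 0"
  using leaf_in_V by (auto simp: leaves_def)

text \<open>The two rays meet at \<open>omega_ray n\<close> at the latest. The length is thus
  logarithmic in the number of leaves.\<close>

lemma card_sep_leaf:
  assumes "b \<in> leaves n" shows "card (sep orig b) \<le> 2 * n"
proof -
  have "(ancestor ^^ n) orig = (ancestor ^^ n) b" using assms leaf_ancestor by (auto simp: leaves_def)
  let ?A = "(\<lambda>k. (ancestor ^^ k) orig) ` {..<n}" and ?B = "(\<lambda>k. (ancestor ^^ k) b) ` {..<n}"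
  have "card (sep orig b) \<le> card (?A \<union> ?B)"
    using sep_subset_chains[OF \<open>_ = _\<close>] by (intro card_mono) auto
  also have "\<dots> \<le> card ?A + card ?B" by (rule card_Un_le)
  also have "\<dots> \<le> n + n" using card_image_le[of "{..<n}"] by (intro add_mono) auto
  finally show ?thesis by simp
qed

text \<open>Rotations fix the root, so all cube points have position \<open>orig\<close> and are
  told apart by portraits alone.\<close>

definition cube_point :: "vertex set \<Rightarrow> vertex \<Rightarrow> vertex" where
  "cube_point A = rot A (Transposition.transpose 0 1)"

lemma swap_permutes: "Transposition.transpose 0 1 permutes {..<q}"
  using q2 by (intro permutes_swap_id) auto

context
  fixes n :: nat
begin

lemma cube_point_DA:
  assumes "A \<subseteq> leaves n" shows "cube_point A \<in> carrier (DA q)"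
  unfolding cube_point_def
proof (rule rot_DA[OF swap_permutes])
  show "fst a = 0" if "a \<in> A" for a using assms that leaves_level by blast
  show "finite A" using assms finite_leaves finite_subset by blast
qed

lemma pos_cube_point:
  assumes "A \<subseteq> leaves n" shows "pos (cube_point A) = orig"
  by (rule pos_eqI[OF DA_Aff[OF cube_point_DA[OF assms]]]) (simp add: cube_point_def)

lemma diff_lp_cube_point:
  assumes A: "A \<subseteq> leaves n" and B: "B \<subseteq> leaves n"
  shows "diff_lp (cube_point A) (cube_point B) = {b. (b \<in> A) \<noteq> (b \<in> B)}"
proof -
  have ne: "Transposition.transpose 0 (1::nat) \<noteq> id"
    by (metis id_apply transpose_apply_first zero_neq_one)
  have "b \<in> diff_lp (cube_point A) (cube_point B) \<longleftrightarrow> (b \<in> A) \<noteq> (b \<in> B)" for b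
  proof (cases "b \<in> V")
    case True
    have lev: "fst a = 0" if "a \<in> A \<or> a \<in> B" for a using A B leaves_level that by blast
    have "lp (cube_point A) b = (if b \<in> A then Transposition.transpose 0 1 else id)"
      "lp (cube_point B) b = (if b \<in> B then Transposition.transpose 0 1 else id)"
      unfolding cube_point_def by (rule lp_rot[OF swap_permutes _ True], use lev in blast)+
    then show ?thesis using True ne by (simp add: diff_lp_def)
  next
    case False
    then have "b \<notin> A" "b \<notin> B" using A B leaves_V by blast+
    then show ?thesis using False by (simp add: diff_lp_def)
  qed
  then show ?thesis by blast
qed

lemma card_diff_edges_cube_edge:
  assumes A: "A \<subseteq> leaves n" and i: "i \<in> leaves n"
  shows "card (diff_edges (cube_point (insert i A)) (cube_point (A - {i}))) \<le> 2 * n"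
proof -
  have iA: "insert i A \<subseteq> leaves n" "A - {i} \<subseteq> leaves n" using A i by auto
  have "{b. (b \<in> insert i A) \<noteq> (b \<in> A - {i})} = {i}" by blast
  then have "diff_edges (cube_point (insert i A)) (cube_point (A - {i})) = sep orig i"
    unfolding diff_edges_eq diff_lp_cube_point[OF iA] pos_cube_point[OF iA(1)] pos_cube_point[OF iA(2)]
    by simp
  then show ?thesis using card_sep_leaf[OF i] by simp
qed

text \<open>Complementary sets differ at every leaf, and each leaf other than \<open>orig\<close> is
  the last edge of its own geodesic from \<open>orig\<close>. The leaf \<open>orig\<close> is the
  common position and is not counted, whence the -1.\<close>

lemma card_diff_edges_cube_diag:
  assumes A: "A \<subseteq> leaves n"
  shows "2 ^ n - 1 \<le> card (diff_edges (cube_point A) (cube_point (leaves n - A)))"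
proof -
  have cA: "leaves n - A \<subseteq> leaves n" by auto
  have "leaves n - {orig} \<subseteq> diff_edges (cube_point A) (cube_point (leaves n - A))"
  proof
    fix b assume b: "b \<in> leaves n - {orig}"
    have "fst orig = fst b" using leaves_level[of b n] b by simp
    then have "\<not> below orig b" using below_level_eq[OF below_refl] b by blast
    then have "b \<in> sep orig b" using b leaves_V[of b n] by (simp add: sep_def)
    moreover have "b \<in> diff_lp (cube_point A) (cube_point (leaves n - A))"
      using b A unfolding diff_lp_cube_point[OF A cA] by blast
    ultimately show "b \<in> diff_edges (cube_point A) (cube_point (leaves n - A))"
      unfolding diff_edges_eq pos_cube_point[OF A] by blast
  qed
  then have "card (leaves n - {orig}) \<le> card (diff_edges (cube_point A) (cube_point (leaves n - A)))"
    using finite_diff_edges[OF cube_point_DA[OF A] cube_point_DA[OF cA]] by (intro card_mono)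
  moreover have "card (leaves n) - 1 \<le> card (leaves n - {orig})"
    using finite_leaves by (simp add: card_Diff_singleton_if)
  ultimately show ?thesis by (simp add: card_leaves)
qed

end

end

section \<open>The upper bound for the compression exponent\<close>

lemma Lp_space_diff:
  assumes p: "1 \<le> p" and f: "f \<in> Lp_space p" and g: "g \<in> Lp_space p"
  shows "integrable (lebesgue_on {0..1}) (\<lambda>x. \<bar>f x - g x\<bar> powr p)"
proof (rule Bochner_Integration.integrable_bound)
  have fg: "f \<in> borel_measurable (lebesgue_on {0..1})" "g \<in> borel_measurable (lebesgue_on {0..1})"
    "integrable (lebesgue_on {0..1}) (\<lambda>x. \<bar>f x\<bar> powr p)" "integrable (lebesgue_on {0..1}) (\<lambda>x. \<bar>g x\<bar> powr p)"
    using f g by (auto simp: Lp_space_def)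
  show "integrable (lebesgue_on {0..1}) (\<lambda>x. 2 powr p / 2 * (\<bar>f x\<bar> powr p + \<bar>g x\<bar> powr p))"
    by (intro integrable_mult_right Bochner_Integration.integrable_add fg)
  show "(\<lambda>x. \<bar>f x - g x\<bar> powr p) \<in> borel_measurable (lebesgue_on {0..1})"
    using fg(1,2) by measurable
  have "\<bar>f x - g x\<bar> powr p \<le> 2 powr p / 2 * (\<bar>f x\<bar> powr p + \<bar>g x\<bar> powr p)" for x
  proof -
    have e: "(2 * f x + - (2 * g x)) / 2 = f x - g x" by (simp add: field_simps)
    show ?thesis
      using abs_mean_powr_le[OF p, of "2 * f x" "- (2 * g x)"] unfolding e
      by (simp add: abs_mult powr_mult algebra_simps)
  qed
  then show "AE x in lebesgue_on {0..1}. norm (\<bar>f x - g x\<bar> powr p)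
      \<le> norm (2 powr p / 2 * (\<bar>f x\<bar> powr p + \<bar>g x\<bar> powr p))"
    by (intro AE_I2) simp
qed

lemma Lp_dist_powr:
  assumes "1 \<le> p"
  shows "Lp_dist p f g powr p = (LINT x|lebesgue_on {0..1}. \<bar>f x - g x\<bar> powr p)"
  using assms by (simp add: Lp_dist_def Lp_norm_def powr_powr)

text \<open>Both sides are sums of p-th powers of distances, so the inequality for real functions
  holds at each point of the interval and can be integrated.\<close>

lemma Lp_cube_ineq:
  fixes p :: real
  assumes p: "1 \<le> p"
  obtains K where "0 \<le> K"
    "\<And>(I :: 'a set) F. finite I \<Longrightarrow> I \<noteq> {} \<Longrightarrow> F \<in> Pow I \<rightarrow> Lp_space p \<Longrightarrow>
       (\<Sum>A\<in>Pow I. Lp_dist p (F A) (F (I - A)) powr p)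
         \<le> K * real (card I) powr max (p / 2 - 1) 0 *
           (\<Sum>A\<in>Pow I. \<Sum>i\<in>I. Lp_dist p (F (insert i A)) (F (A - {i})) powr p)"
proof -
  obtain K where K: "0 \<le> K" "\<And>(I :: 'a set) f. finite I \<Longrightarrow> I \<noteq> {} \<Longrightarrow>
       cube_diag p I f \<le> K * real (card I) powr max (p / 2 - 1) 0 * cube_edge p I f"
    using cube_ineq[OF p] by blast
  show ?thesis
  proof (rule that[OF K(1)])
    fix I :: "'a set" and F assume I: "finite I" "I \<noteq> {}" and "F \<in> Pow I \<rightarrow> Lp_space p"
    then have F: "F A \<in> Lp_space p" if "A \<subseteq> I" for A using that by auto
    let ?M = "lebesgue_on {0..1 :: real}" and ?c = "K * real (card I) powr max (p / 2 - 1) 0"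
    have d: "integrable ?M (\<lambda>t. \<bar>F A t - F (I - A) t\<bar> powr p)" if "A \<in> Pow I" for A
      using that by (intro Lp_space_diff[OF p] F) auto
    have e: "integrable ?M (\<lambda>t. \<bar>F (insert i A) t - F (A - {i}) t\<bar> powr p)" if "A \<in> Pow I" "i \<in> I" for A i
      using that by (intro Lp_space_diff[OF p] F) auto
    have "(\<Sum>A\<in>Pow I. Lp_dist p (F A) (F (I - A)) powr p) = (LINT t|?M. cube_diag p I (\<lambda>A. F A t))"
      unfolding Lp_dist_powr[OF p] cube_diag_def
      using d by (intro Bochner_Integration.integral_sum[symmetric]) auto
    also have "\<dots> \<le> (LINT t|?M. ?c * cube_edge p I (\<lambda>A. F A t))"
    proof (rule integral_mono)
      show "integrable ?M (\<lambda>t. cube_diag p I (\<lambda>A. F A t))"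
        unfolding cube_diag_def using d by (intro Bochner_Integration.integrable_sum) auto
      show "integrable ?M (\<lambda>t. ?c * cube_edge p I (\<lambda>A. F A t))"
        unfolding cube_edge_def using e
        by (intro integrable_mult_right Bochner_Integration.integrable_sum) auto
    qed (use K(2)[OF I] in blast)
    also have "\<dots> = ?c * (LINT t|?M. cube_edge p I (\<lambda>A. F A t))" by simp
    also have "(LINT t|?M. cube_edge p I (\<lambda>A. F A t))
        = (\<Sum>A\<in>Pow I. LINT t|?M. (\<Sum>i\<in>I. \<bar>F (insert i A) t - F (A - {i}) t\<bar> powr p))"
      unfolding cube_edge_def using e
      by (intro Bochner_Integration.integral_sum Bochner_Integration.integrable_sum) auto
    also have "\<dots> = (\<Sum>A\<in>Pow I. \<Sum>i\<in>I. Lp_dist p (F (insert i A)) (F (A - {i})) powr p)"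
      unfolding Lp_dist_powr[OF p] using e
      by (intro sum.cong refl Bochner_Integration.integral_sum) auto
    finally show "(\<Sum>A\<in>Pow I. Lp_dist p (F A) (F (I - A)) powr p)
         \<le> ?c * (\<Sum>A\<in>Pow I. \<Sum>i\<in>I. Lp_dist p (F (insert i A)) (F (A - {i})) powr p)" .
  qed
qed

text \<open>For positive \<delta>, the p-th root of the hypothesis bounds 1 by a constant times
  \<open>(2 * n + 1) * x ^ n\<close> with \<open>x < 1\<close>, which tends to 0.\<close>

lemma exponential_le_polynomial_imp_nonpos:
  fixes \<delta> Q p :: real
  assumes p: "0 < p" and Q: "0 \<le> Q"
    and le: "\<And>n. 1 \<le> n \<Longrightarrow> (2 ^ n) powr \<delta> \<le> Q * (2 * real n + 1) powr p"
  shows "\<delta> \<le> 0"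
proof (rule ccontr)
  assume "\<not> \<delta> \<le> 0"
  define x where "x = 2 powr (- (\<delta> / p))"
  have x: "0 < x" "x < 1" using \<open>\<not> \<delta> \<le> 0\<close> p powr_less_cancel_iff[of 2 "- (\<delta> / p)" 0] by (simp_all add: x_def)
  have xn: "((2 ^ n) powr \<delta>) powr (1 / p) * x ^ n = 1" for n
  proof -
    have "((2 ^ n) powr \<delta>) powr (1 / p) = 2 powr (real n * (\<delta> / p))"
      by (simp add: powr_powr flip: powr_realpow)
    moreover have "x ^ n = 2 powr (- (real n * (\<delta> / p)))"
      by (simp add: x_def powr_power mult.commute)
    ultimately show ?thesis by (simp flip: powr_add)
  qed
  have "1 \<le> Q powr (1 / p) * (2 * (real n * x ^ n) + x ^ n)" if "1 \<le> n" for n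
  proof -
    have "((2 ^ n) powr \<delta>) powr (1 / p) \<le> (Q * (2 * real n + 1) powr p) powr (1 / p)"
      using le[OF that] p by (intro powr_mono2) auto
    also have "\<dots> = Q powr (1 / p) * (2 * real n + 1)"
      using p Q by (simp add: powr_mult powr_powr)
    finally have "((2 ^ n) powr \<delta>) powr (1 / p) * x ^ n \<le> Q powr (1 / p) * (2 * real n + 1) * x ^ n"
      using x by (intro mult_right_mono) auto
    then show ?thesis unfolding xn by (simp add: algebra_simps)
  qed
  moreover have "(\<lambda>n. Q powr (1 / p) * (2 * (real n * x ^ n) + x ^ n)) \<longlonglongrightarrow> Q powr (1 / p) * (2 * 0 + 0)"
    using x powser_times_n_limit_0[of x] by (intro tendsto_intros LIMSEQ_power_zero) auto
  ultimately have "(1::real) \<le> Q powr (1 / p) * (2 * 0 + 0)"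
    by (intro tendsto_lowerbound[where F = sequentially]) (auto intro!: eventually_sequentiallyI[of 1])
  then show False by simp
qed

context regular_tree
begin

lemma compression_upper_bound:
  fixes p a c :: real
  assumes p: "1 \<le> p" and S: "finite_generating_set (DA q) S" and a: "0 \<le> a" and c: "0 < c"
    and lip: "lipschitz_into_Lp p (DA q) S f"
    and low: "\<And>x y. x \<in> carrier (DA q) \<Longrightarrow> y \<in> carrier (DA q) \<Longrightarrow>
      c * word_dist (DA q) S x y powr a \<le> Lp_dist p (f x) (f y)"
  shows "a \<le> max (1 / p) (1 / 2)"
proof -
  let ?D = "carrier (DA q)" and ?d = "word_dist (DA q) S" and ?s = "max (p / 2 - 1) 0"
  obtain C :: real where C: "1 \<le> C"
    "\<And>x y. x \<in> ?D \<Longrightarrow> y \<in> ?D \<Longrightarrow> real (card (diff_edges x y)) \<le> C * ?d x y"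
    "\<And>x y. x \<in> ?D \<Longrightarrow> y \<in> ?D \<Longrightarrow> ?d x y \<le> C * (real (card (diff_edges x y)) + 1)"
    using word_dist_diff_edges[OF S] by metis
  have fLp: "f x \<in> Lp_space p" if "x \<in> ?D" for x using lip that by (auto simp: lipschitz_into_Lp_def)
  obtain L0 where L0: "\<And>x y. x \<in> ?D \<Longrightarrow> y \<in> ?D \<Longrightarrow> Lp_dist p (f x) (f y) \<le> L0 * ?d x y"
    using lip by (auto simp: lipschitz_into_Lp_def)
  \<comment> \<open>\<open>L0\<close> may have either sign, but later estimates raise the constant
    to the power p.\<close>
  define L where "L = max L0 0"
  have L: "Lp_dist p (f x) (f y) \<le> L * ?d x y" if "x \<in> ?D" "y \<in> ?D" for x y
  proof -
    have "L0 * ?d x y \<le> L * ?d x y" by (intro mult_right_mono) (auto simp: L_def word_dist_def)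
    then show ?thesis using L0[OF that] by simp
  qed
  have L_0: "0 \<le> L" by (simp add: L_def)
  obtain K where K: "0 \<le> K"
    "\<And>(I :: vertex set) F. finite I \<Longrightarrow> I \<noteq> {} \<Longrightarrow> F \<in> Pow I \<rightarrow> Lp_space p \<Longrightarrow>
       (\<Sum>A\<in>Pow I. Lp_dist p (F A) (F (I - A)) powr p)
         \<le> K * real (card I) powr ?s *
           (\<Sum>A\<in>Pow I. \<Sum>i\<in>I. Lp_dist p (F (insert i A)) (F (A - {i})) powr p)"
    using Lp_cube_ineq[OF p, where 'a = vertex] by blast
  \<comment> \<open>Diagonals have at least 2^n - 1 >= 2^n / 2 differing edges and hence word length
    at least 2^n / (2 C).\<close>
  define c1 where "c1 = (c * (1 / (2 * C)) powr a) powr p"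
  define Q where "Q = K * (L * C) powr p / c1"
  have c1: "0 < c1" using c C(1) by (simp add: c1_def)
  have Lp0: "0 \<le> Lp_dist p u v" for u v by (simp add: Lp_dist_def Lp_norm_def)
  \<comment> \<open>With N = 2^n, the exponent \<open>?s\<close> comes from the cube inequality and
    the 1 from the N edges at each point of the cube. The number of cube points cancels.\<close>
  have "(2 ^ n) powr (a * p - ?s - 1) \<le> Q * (2 * real n + 1) powr p" if n: "1 \<le> n" for n :: nat
  proof -
    let ?I = "leaves n" and ?F = "\<lambda>A. f (cube_point A)" and ?N = "2 ^ n :: real"
    let ?k = "real (card (Pow ?I))"
    have DA: "cube_point A \<in> ?D" if "A \<subseteq> ?I" for A using cube_point_DA that by blast
    have k: "0 < ?k" using finite_leaves by (auto simp: card_gt_0_iff)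
    have diag: "c1 * ?N powr (a * p) \<le> Lp_dist p (?F A) (?F (?I - A)) powr p" if "A \<in> Pow ?I" for A
    proof -
      have A: "A \<subseteq> ?I" "?I - A \<subseteq> ?I" using that by auto
      let ?x = "cube_point A" and ?y = "cube_point (?I - A)"
      have "(2::real) ^ 1 \<le> ?N" using n by (intro power_increasing) auto
      moreover have "?N - 1 \<le> real (card (diff_edges ?x ?y))"
        using of_nat_mono[OF card_diff_edges_cube_diag[OF A(1)], where 'a = real] by (simp add: of_nat_diff)
      ultimately have "?N / 2 \<le> C * ?d ?x ?y" using C(2)[OF DA[OF A(1)] DA[OF A(2)]] by simp
      then have "1 / (2 * C) * ?N \<le> ?d ?x ?y" using C(1) by (simp add: field_simps)
      then have "(1 / (2 * C) * ?N) powr a \<le> ?d ?x ?y powr a"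
        using C(1) a by (intro powr_mono2) auto
      moreover have "(1 / (2 * C) * ?N) powr a = (1 / (2 * C)) powr a * ?N powr a"
        using C(1) by (intro powr_mult)
      ultimately have "(1 / (2 * C)) powr a * ?N powr a \<le> ?d ?x ?y powr a" by (simp only:)
      then have "c * ((1 / (2 * C)) powr a * ?N powr a) \<le> c * ?d ?x ?y powr a"
        using c by (intro mult_left_mono) auto
      also have "\<dots> \<le> Lp_dist p (f ?x) (f ?y)" by (rule low[OF DA[OF A(1)] DA[OF A(2)]])
      finally have "(c * (1 / (2 * C)) powr a * ?N powr a) powr p \<le> Lp_dist p (f ?x) (f ?y) powr p"
        using c p by (intro powr_mono2) (auto simp: mult.assoc)
      moreover have "(c * (1 / (2 * C)) powr a * ?N powr a) powr p = c1 * ?N powr (a * p)"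
        using c by (simp add: c1_def powr_mult powr_powr)
      ultimately show ?thesis by simp
    qed
    have edge: "Lp_dist p (?F (insert i A)) (?F (A - {i})) powr p \<le> (L * C) powr p * (2 * real n + 1) powr p"
      if "A \<in> Pow ?I" "i \<in> ?I" for A i
    proof -
      have A: "A \<subseteq> ?I" "insert i A \<subseteq> ?I" "A - {i} \<subseteq> ?I" using that by auto
      let ?x = "cube_point (insert i A)" and ?y = "cube_point (A - {i})"
      have "real (card (diff_edges ?x ?y)) \<le> 2 * real n"
        using of_nat_mono[OF card_diff_edges_cube_edge[OF A(1) that(2)], where 'a = real] by simp
      then have "C * (real (card (diff_edges ?x ?y)) + 1) \<le> C * (2 * real n + 1)"
        using C(1) by (intro mult_left_mono) auto
      then have "?d ?x ?y \<le> C * (2 * real n + 1)" using C(3)[OF DA[OF A(2)] DA[OF A(3)]] by simp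
      then have "L * ?d ?x ?y \<le> L * (C * (2 * real n + 1))" using L_0 by (rule mult_left_mono)
      then have "Lp_dist p (f ?x) (f ?y) \<le> L * C * (2 * real n + 1)"
        using L[OF DA[OF A(2)] DA[OF A(3)]] by (simp add: mult.assoc)
      then have "Lp_dist p (f ?x) (f ?y) powr p \<le> (L * C * (2 * real n + 1)) powr p"
        using Lp0 p by (intro powr_mono2) auto
      also have "\<dots> = (L * C) powr p * (2 * real n + 1) powr p" using L_0 C(1) by (simp add: powr_mult)
      finally show ?thesis .
    qed
    have N: "real (card ?I) = ?N" by (simp add: card_leaves)
    have "?k * (c1 * ?N powr (a * p)) = (\<Sum>A\<in>Pow ?I. c1 * ?N powr (a * p))" by simp
    also have "\<dots> \<le> (\<Sum>A\<in>Pow ?I. Lp_dist p (?F A) (?F (?I - A)) powr p)"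
      by (intro sum_mono diag)
    also have "\<dots> \<le> K * ?N powr ?s *
           (\<Sum>A\<in>Pow ?I. \<Sum>i\<in>?I. Lp_dist p (?F (insert i A)) (?F (A - {i})) powr p)"
      unfolding N[symmetric]
    proof (rule K(2))
      show "?I \<noteq> {}" by (auto simp: leaves_def)
    qed (use finite_leaves fLp DA in auto)
    also have "\<dots> \<le> K * ?N powr ?s * (\<Sum>A\<in>Pow ?I. \<Sum>i\<in>?I. (L * C) powr p * (2 * real n + 1) powr p)"
      using K(1) by (intro mult_left_mono sum_mono edge) auto
    also have "\<dots> = ?k * (K * ?N powr ?s * ?N * ((L * C) powr p * (2 * real n + 1) powr p))"
      by (simp add: card_leaves)
    finally have "c1 * ?N powr (a * p) \<le> K * ?N powr ?s * ?N * ((L * C) powr p * (2 * real n + 1) powr p)"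
      using k by simp
    then have "?N powr (a * p) \<le> ?N powr ?s * ?N * (Q * (2 * real n + 1) powr p)"
      using c1 by (simp add: Q_def field_simps)
    moreover have "?N powr (a * p) = ?N powr ?s * ?N * ?N powr (a * p - ?s - 1)"
    proof -
      have "?N powr ?s * ?N powr 1 * ?N powr (a * p - ?s - 1) = ?N powr (a * p)"
        unfolding powr_add[symmetric] by simp
      then show ?thesis by simp
    qed
    ultimately show ?thesis by (simp add: mult_le_cancel_left)
  qed
  then have "a * p - ?s - 1 \<le> 0"
    using p K(1) c1 by (intro exponential_le_polynomial_imp_nonpos[of p Q]) (auto simp: Q_def)
  then have "a * p \<le> max (p / 2) 1" by (auto simp: max_def split: if_splits)
  then have "a \<le> max (p / 2) 1 / p" using p by (simp add: field_simps)
  also have "\<dots> = max (1 / p) (1 / 2)" using p by (auto simp: max_def field_simps)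
  finally show ?thesis .
qed

lemma compression_exponent_DA:
  fixes p :: real
  assumes p: "1 \<le> p" and S: "finite_generating_set (DA q) S"
  shows "compression_exponent p (DA q) S = ereal (max (1 / p) (1 / 2))"
  unfolding compression_exponent_def
proof (rule antisym)
  obtain f c where "lipschitz_into_Lp p (DA q) S f" "0 < c"
    "\<And>x y. x \<in> carrier (DA q) \<Longrightarrow> y \<in> carrier (DA q) \<Longrightarrow>
      c * word_dist (DA q) S x y powr max (1 / p) (1 / 2) \<le> Lp_dist p (f x) (f y)"
    using Lp_embedding_DA[OF p S] by metis
  moreover have "0 \<le> max (1 / p) (1 / 2)" by simp
  ultimately show "ereal (max (1 / p) (1 / 2)) \<le> Sup {ereal a | a. 0 \<le> a \<and>
     (\<exists>f c. lipschitz_into_Lp p (DA q) S f \<and> c > 0 \<and>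
        (\<forall>x\<in>carrier (DA q). \<forall>y\<in>carrier (DA q).
           Lp_dist p (f x) (f y) \<ge> c * word_dist (DA q) S x y powr a))}"
    by (intro Sup_upper) blast
  show "Sup {ereal a | a. 0 \<le> a \<and>
     (\<exists>f c. lipschitz_into_Lp p (DA q) S f \<and> c > 0 \<and>
        (\<forall>x\<in>carrier (DA q). \<forall>y\<in>carrier (DA q).
           Lp_dist p (f x) (f y) \<ge> c * word_dist (DA q) S x y powr a))} \<le> ereal (max (1 / p) (1 / 2))"
  proof (rule Sup_least, clarify)
    fix a f c
    assume "0 \<le> a" "lipschitz_into_Lp p (DA q) S f" "0 < c"
      and "\<forall>x\<in>carrier (DA q). \<forall>y\<in>carrier (DA q). c * word_dist (DA q) S x y powr a \<le> Lp_dist p (f x) (f y)"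
    then have "a \<le> max (1 / p) (1 / 2)" using compression_upper_bound[OF p S] by blast
    then show "ereal a \<le> ereal (max (1 / p) (1 / 2))" by (simp only: ereal_less_eq)
  qed
qed

lemma bilipschitz_DA:
  assumes S: "finite_generating_set (DA q) S"
  shows "\<exists>f. bilipschitz_into_Lp 1 (DA q) S f"
proof -
  obtain f c where f: "lipschitz_into_Lp 1 (DA q) S f" "0 < c"
    and low: "\<And>x y. x \<in> carrier (DA q) \<Longrightarrow> y \<in> carrier (DA q) \<Longrightarrow>
      c * word_dist (DA q) S x y powr max (1 / 1) (1 / 2) \<le> Lp_dist 1 (f x) (f y)"
    using Lp_embedding_DA[of 1, OF _ S] by auto
  have "word_dist (DA q) S x y powr max (1 / 1) (1 / 2) = word_dist (DA q) S x y" for x y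
    by (simp add: word_dist_def)
  then have "\<forall>x\<in>carrier (DA q). \<forall>y\<in>carrier (DA q). c * word_dist (DA q) S x y \<le> Lp_dist 1 (f x) (f y)"
    using low by metis
  then show ?thesis using f unfolding bilipschitz_into_Lp_def by blast
qed

end

theorem proposition1p2:
  fixes q :: nat and S :: "(vertex \<Rightarrow> vertex) set"
  assumes "q \<ge> 2"
    and "finite_generating_set (DA q) S"
  shows "(\<exists>f. bilipschitz_into_Lp 1 (DA q) S f) \<and>
    (\<forall>p::real. p \<ge> 1 \<longrightarrow> compression_exponent p (DA q) S = ereal (max (1 / p) (1 / 2)))"
proof -
  interpret regular_tree q using assms(1) by unfold_locales
  show ?thesis using bilipschitz_DA[OF assms(2)] compression_exponent_DA[OF _ assms(2)] by blast
qed

end
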